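(* Let $(P,\le_P)$ be a finite (3+1)-free poset and let $r\ge1$. For $A,A'\in\mathcal A_P$ we have $f_r(A)=A'$ if and only if $e_r(A')=A$.
   Context: A poset is (3+1)-free if it does not contain as an induced subposet the disjoint union of a 3-element chain and a 1-element chain. $\mathbb Z_+$ is the set of positive integers. $P$-arrays. A $P$-array is an indexing $A=\{A_{i,j}\}$ of the elements of $P$ (each element of $P$ occurs exactly once) by positions $(i,j)\in\mathbb Z_+\times\mathbb Z_+$ such that if $A_{i,j}$ is defined with $j>1$ then $A_{i,j-1}$ is defined and $A_{i,j-1}<_P A_{i,j}$. So a $P$-array amounts to an assignment of the elements of $P$ to rows indexed by $\mathbb Z_+$, each row being a chain listed in increasing order. $\mathcal A_P$ is the set of $P$-arrays. The $r$ alignment. Let $A$ be a $P$-array, $r\ge1$, and let $a_1<_P\cdots<_Pa_m$ and $b_1<_P\cdots<_Pb_n$ be the elements of rows $r$ and $r+1$ of $A$. Define $C(b_k)=k$ and, inductively, $C(a_k)=\max(\{C(b_i)\mid b_i<_Pa_k\}\cup\{C(a_i)\mid 1\le i<k\})+1$ (with $\max\emptyset=0$). The $r$ pre-alignment $\phi_0:\{a_1,\dots,a_m,b_1,\dots,b_n\}\to\{r,r+1\}\times\mathbb Z_+$ sends $a_k\mapsto(r,C(a_k))$ and $b_k\mapsto(r+1,C(b_k))$; the second coordinate is called the column. Given $\phi_k$, select the rightmost element $x$, say mapped to $(i,c)$, such that column $c+1$ of $\phi_k$ is nonempty and contains no $y>_Px$, if such $x$ exists; then $\phi_{k+1}(x)=(i,c+1)$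 and $\phi_{k+1}=\phi_k$ elsewhere. If no such $x$ exists, $\phi_k$ is the $r$ alignment of $A$. Operators $f_r,e_r:\mathcal A_P\to\mathcal A_P\cup\{0\}$, where, for $A\in\mathcal A_P$, $a_1<_P\cdots<_Pa_m$ and $b_1<_P\cdots<_Pb_n$ are the elements of rows $r$ and $r+1$ of $A$, and "column" means column in the $r$ alignment of $A$. Lowering: if every column with an entry in row $r$ also contains an entry in row $r+1$, then $f_r(A)=0$. Otherwise let $p$ be minimal such that $a_p$ does not share a column with an element of row $r+1$, and let $t\ge0$ be minimal such that there is no $b_i\not>_Pa_{p+t}$ one column right of $a_{p+t}$. Then $f_r(A)$ is obtained from $A$ by moving $a_p,\dots,a_{p+t}$ to row $r+1$ and any $b_i$ that shares a column with one of these entries to row $r$. Raising: if every column with an entry in row $r+1$ also contains an entry in row $r$, then $e_r(A)=0$. Otherwise let $p$ be maximal such that $b_p$ does not share a column with an entry of row $r$, and let $t\ge0$ be minimal such that there is no $a_i\not>_Pb_{p+t}$ one column right of $b_{p+t}$. Then $e_r(A)$ is obtained from $A$ by moving $b_p,\dots,b_{p+t}$ to row $r$ and any $a_i$ that shares a column with one of these entries to row $r+1$. *)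

theory Defs
  imports Main
begin

text \<open>
  A poset is a carrier \<open>P\<close> with a relation \<open>R\<close> such that \<^term>\<open>partial_order_on P R\<close>;
  \<open>R\<close> is the reflexive order.
\<close>

definition strictly_below :: "'a rel \<Rightarrow> 'a \<Rightarrow> 'a \<Rightarrow> bool" where
  "strictly_below R x y \<longleftrightarrow> (x, y) \<in> R \<and> x \<noteq> y"

definition incomparable :: "'a rel \<Rightarrow> 'a \<Rightarrow> 'a \<Rightarrow> bool" where
  "incomparable R x y \<longleftrightarrow> (x, y) \<notin> R \<and> (y, x) \<notin> R"

definition three_plus_one_free :: "'a set \<Rightarrow> 'a rel \<Rightarrow> bool" where
  "three_plus_one_free P R \<longleftrightarrow>
     \<not> (\<exists>x\<in>P. \<exists>y\<in>P. \<exists>z\<in>P. \<exists>w\<in>P.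
          strictly_below R x y \<and> strictly_below R y z \<and>
          incomparable R w x \<and> incomparable R w y \<and> incomparable R w z)"

text \<open>
  Positions \<open>(i, j)\<close> are pairs of positive integers; an array is a partial map from positions.
\<close>

type_synonym 'a parray = "nat \<times> nat \<rightharpoonup> 'a"

definition P_arrays :: "'a set \<Rightarrow> 'a rel \<Rightarrow> 'a parray set" where
  "P_arrays P R = {A.
     dom A \<subseteq> {1..} \<times> {1..} \<and>
     ran A = P \<and> inj_on A (dom A) \<and>
     (\<forall>i j x. A (i, j) = Some x \<longrightarrow> j > 1 \<longrightarrow>
        (\<exists>y. A (i, j - 1) = Some y \<and> strictly_below R y x))}"

definition row_elems :: "'a parray \<Rightarrow> nat \<Rightarrow> 'a set" where
  "row_elems A i = {x. \<exists>j. A (i, j) = Some x}"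

definition index_in_row :: "'a parray \<Rightarrow> nat \<Rightarrow> 'a \<Rightarrow> nat" where
  "index_in_row A i x = (THE j. A (i, j) = Some x)"

text \<open>
  \<open>pre_col R A r k\<close> is \<open>C(a\<^sub>k)\<close> where \<open>a\<^sub>k = A (r, k)\<close>. Since \<open>C(b\<^sub>i) = i\<close>, the columns of the
  \<open>b\<^sub>i\<close> are the indices \<open>i\<close> themselves. Inserting \<open>0\<close> implements the convention \<open>max \<emptyset> = 0\<close>.
\<close>

function pre_col :: "'a rel \<Rightarrow> 'a parray \<Rightarrow> nat \<Rightarrow> nat \<Rightarrow> nat" where
  "pre_col R A r k =
     Max (insert 0
       ({i. \<exists>a b. A (r, k) = Some a \<and> A (r + 1, i) = Some b \<and> strictly_below R b a} \<union>
        (\<lambda>i. pre_col R A r i) ` {1..<k})) + 1"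
  by pat_completeness auto
termination by (relation "Wellfounded.measure (\<lambda>(R, A, r, k). k)") auto

declare pre_col.simps [simp del]

text \<open>
  A pre-alignment never changes the row of an element, so only the column is recorded. Columns are
  meaningful only for elements of rows \<open>r\<close> and \<open>r + 1\<close>.
\<close>

definition pre_alignment :: "'a rel \<Rightarrow> 'a parray \<Rightarrow> nat \<Rightarrow> 'a \<Rightarrow> nat" where
  "pre_alignment R A r x =
     (if x \<in> row_elems A r then pre_col R A r (index_in_row A r x)
      else index_in_row A (r + 1) x)"

definition column :: "'a parray \<Rightarrow> nat \<Rightarrow> ('a \<Rightarrow> nat) \<Rightarrow> nat \<Rightarrow> 'a set" where
  "column A r \<phi> c = {x \<in> row_elems A r \<union> row_elems A (r + 1). \<phi> x = c}"

definition movable :: "'a rel \<Rightarrow> 'a parray \<Rightarrow> nat \<Rightarrow> ('a \<Rightarrow> nat) \<Rightarrow> 'a \<Rightarrow> bool" where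
  "movable R A r \<phi> x \<longleftrightarrow>
     x \<in> row_elems A r \<union> row_elems A (r + 1) \<and>
     column A r \<phi> (\<phi> x + 1) \<noteq> {} \<and>
     \<not> (\<exists>y \<in> column A r \<phi> (\<phi> x + 1). strictly_below R x y)"

text \<open>
  The sequence \<open>\<phi>\<^sub>0, \<phi>\<^sub>1, \<dots>\<close>, continued constantly once no element is movable. The rightmost
  movable element is unique: columns increase strictly along each row, so of two elements sharing
  a column at least one has a larger element in the next column, if that column is nonempty.
\<close>

primrec alignment_seq :: "'a rel \<Rightarrow> 'a parray \<Rightarrow> nat \<Rightarrow> nat \<Rightarrow> 'a \<Rightarrow> nat" where
  "alignment_seq R A r 0 = pre_alignment R A r"
| "alignment_seq R A r (Suc k) =
     (let \<phi> = alignment_seq R A r k in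
      if \<exists>x. movable R A r \<phi> x
      then (let x = (ARG_MAX \<phi> x. movable R A r \<phi> x) in \<phi>(x := \<phi> x + 1))
      else \<phi>)"

definition alignment :: "'a rel \<Rightarrow> 'a parray \<Rightarrow> nat \<Rightarrow> 'a \<Rightarrow> nat" where
  "alignment R A r =
     alignment_seq R A r (LEAST k. \<not> (\<exists>x. movable R A r (alignment_seq R A r k) x))"

text \<open>
  The array whose \<open>i\<close>-th row lists \<open>S i\<close> in increasing order: in a finite chain, \<open>x\<close> is the
  \<open>j\<close>-th smallest element iff exactly \<open>j\<close> elements are \<open>\<le> x\<close>. If the sets \<open>S i\<close> partition \<open>P\<close>
  but are not all chains, the result is not a \<open>P\<close>-array.
\<close>

definition array_of_rows :: "'a rel \<Rightarrow> (nat \<Rightarrow> 'a set) \<Rightarrow> 'a parray" where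
  "array_of_rows R S = (\<lambda>(i, j).
     if \<exists>x \<in> S i. card {y \<in> S i. (y, x) \<in> R} = j
     then Some (THE x. x \<in> S i \<and> card {y \<in> S i. (y, x) \<in> R} = j)
     else None)"

text \<open>
  \<open>exchange R A i i' X Y\<close> moves \<open>X\<close> from row \<open>i\<close> to row \<open>i'\<close>, and \<open>Y\<close> from row \<open>i'\<close> to row \<open>i\<close>.
\<close>

definition exchange ::
    "'a rel \<Rightarrow> 'a parray \<Rightarrow> nat \<Rightarrow> nat \<Rightarrow> 'a set \<Rightarrow> 'a set \<Rightarrow> 'a parray" where
  "exchange R A i i' X Y = array_of_rows R
     ((row_elems A)(i := (row_elems A i - X) \<union> Y, i' := (row_elems A i' - Y) \<union> X))"

text \<open>
  In the operators below, \<open>i\<close> is the row that the \<open>p\<close>-th to \<open>(p+t)\<close>-th elements leave and \<open>i'\<close> the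
  row they enter.
\<close>

definition unpaired :: "'a parray \<Rightarrow> nat \<Rightarrow> nat \<Rightarrow> ('a \<Rightarrow> nat) \<Rightarrow> nat \<Rightarrow> bool" where
  "unpaired A i i' \<phi> p \<longleftrightarrow>
     (\<exists>x. A (i, p) = Some x \<and> \<not> (\<exists>y \<in> row_elems A i'. \<phi> y = \<phi> x))"

definition run_length ::
    "'a rel \<Rightarrow> 'a parray \<Rightarrow> nat \<Rightarrow> nat \<Rightarrow> ('a \<Rightarrow> nat) \<Rightarrow> nat \<Rightarrow> nat" where
  "run_length R A i i' \<phi> p =
     (LEAST t. \<exists>x. A (i, p + t) = Some x \<and>
        \<not> (\<exists>y \<in> row_elems A i'. \<phi> y = \<phi> x + 1 \<and> \<not> strictly_below R x y))"

definition move_run ::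
    "'a rel \<Rightarrow> 'a parray \<Rightarrow> nat \<Rightarrow> nat \<Rightarrow> ('a \<Rightarrow> nat) \<Rightarrow> nat \<Rightarrow> 'a parray" where
  "move_run R A i i' \<phi> p =
     (let t = run_length R A i i' \<phi> p;
          X = {x. \<exists>k \<in> {p..p + t}. A (i, k) = Some x};
          Y = {y \<in> row_elems A i'. \<exists>x \<in> X. \<phi> y = \<phi> x}
      in exchange R A i i' X Y)"

text \<open>\<^term>\<open>None\<close> plays the role of the value \<open>0\<close>.\<close>

definition lowering :: "'a rel \<Rightarrow> nat \<Rightarrow> 'a parray \<Rightarrow> 'a parray option" where
  "lowering R r A =
     (let \<phi> = alignment R A r in
      if \<forall>x \<in> row_elems A r. \<exists>y \<in> row_elems A (r + 1). \<phi> y = \<phi> x then None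
      else Some (move_run R A r (r + 1) \<phi> (LEAST p. unpaired A r (r + 1) \<phi> p)))"

definition raising :: "'a rel \<Rightarrow> nat \<Rightarrow> 'a parray \<Rightarrow> 'a parray option" where
  "raising R r A =
     (let \<phi> = alignment R A r in
      if \<forall>y \<in> row_elems A (r + 1). \<exists>x \<in> row_elems A r. \<phi> x = \<phi> y then None
      else Some (move_run R A (r + 1) r \<phi> (GREATEST p. unpaired A (r + 1) r \<phi> p)))"

end

theory Submission
  imports Defs
begin

text \<open>
  Both operators exchange the two rows inside an interval of columns and leave every column as it
  is. They therefore undo each other as soon as the alignment of the new array has the same columns
  as the alignment of the old one. The whole proof consists in making this persistence of the
  columns visible.

  Write \<open>U\<close> and \<open>L\<close> for the rows \<open>r\<close> and \<open>r + 1\<close> (the upper row holds the \<open>a\<^sub>k\<close>, the lower one the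
  \<open>b\<^sub>k\<close>), and call an element solo if it is alone in its column. In the alignment, every solo element
  \<open>x\<^sub>0\<close> starts a block: columns \<open>{x\<^sub>0}, {x\<^sub>1, y\<^sub>1}, \<dots>, {x\<^sub>t, y\<^sub>t}\<close> with \<open>x\<^sub>0 < \<dots> < x\<^sub>t\<close> in one row and each
  \<open>y\<^sub>k\<close> incomparable to \<open>x\<^sub>k\<^sub>-\<^sub>1\<close> and to \<open>x\<^sub>k\<close>, such that everything left of the block is below the block,
  and everything right of the block is above it. Thus a block is a component of the incomparability
  graph, a path with an odd number of vertices, and its two colour classes can be exchanged freely.
  The run that an operator moves, together with the elements sharing its columns, is exactly the
  block of the first solo element of \<open>U\<close> (lowering) or of the last solo element of \<open>L\<close> (raising).

  The existence of blocks, together with some elementary conditions (increasing rows, no empty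
  columns, solo elements of \<open>L\<close> to the left of those of \<open>U\<close>, and \<open>\<phi> b < \<phi> a\<close> whenever \<open>b < a\<close> with
  \<open>a\<close> in \<open>U\<close> and \<open>b\<close> in \<open>L\<close>), is the predicate \<open>aligned\<close>. Three facts about it give the result:

  \<^item> the alignment is aligned (\<open>aligned_alignment\<close>). An invariant holds for the pre-alignment and
    survives every move, and it implies \<open>aligned\<close> when no element can move any more;
  \<^item> two aligned column functions for the same two rows are equal (\<open>aligned_unique\<close>);
  \<^item> after the exchange of the block of the first solo element of \<open>U\<close>, or of the last one of \<open>L\<close>, the
    same columns are aligned for the new rows (\<open>aligned_swapped\<close>).

  Hence the new array has the old columns as its alignment. After a lowering, the solo element that
  was first in \<open>U\<close> has become the last one in \<open>L\<close> and has the same block, so that raising exchanges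
  this block back; the converse is symmetric. Freeness of \<open>3 + 1\<close> enters only through the
  comparability of an element with one of three given elements of the other row.
\<close>

section \<open>Columns of two chains\<close>

text \<open>
  Freeness of \<open>3 + 1\<close> is expressed as the comparability of \<open>w\<close> with a member of each three-element
  chain; in this form it also covers the case that \<open>w\<close> belongs to the chain.
\<close>

locale free_order =
  fixes P :: "'a set" and less :: "'a \<Rightarrow> 'a \<Rightarrow> bool" (infix "\<prec>" 50)
  assumes finite_P: "finite P"
    and irrefl: "\<not> x \<prec> x"
    and trans: "x \<prec> y \<Longrightarrow> y \<prec> z \<Longrightarrow> x \<prec> z"
    and free: "\<lbrakk>x \<in> P; y \<in> P; z \<in> P; w \<in> P; x \<prec> y; y \<prec> z\<rbrakk>
      \<Longrightarrow> w \<prec> x \<or> x \<prec> w \<or> w \<prec> y \<or> y \<prec> w \<or> w \<prec> z \<or> z \<prec> w"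
begin

definition increasing :: "'a set \<Rightarrow> ('a \<Rightarrow> nat) \<Rightarrow> bool" where
  "increasing S \<phi> \<longleftrightarrow>
     (\<forall>x\<in>S. \<forall>y\<in>S. x \<noteq> y \<longrightarrow> x \<prec> y \<and> \<phi> x < \<phi> y \<or> y \<prec> x \<and> \<phi> y < \<phi> x)"

definition gapless :: "'a set \<Rightarrow> ('a \<Rightarrow> nat) \<Rightarrow> bool" where
  "gapless E \<phi> \<longleftrightarrow> (\<forall>x\<in>E. 1 \<le> \<phi> x \<and> (1 < \<phi> x \<longrightarrow> (\<exists>y\<in>E. \<phi> y + 1 = \<phi> x)))"

text \<open>
  With increasing rows, a column holds at most one element of each row, so that this says that \<open>x\<close>
  is alone in its column.
\<close>
definition solo :: "'a set \<Rightarrow> 'a set \<Rightarrow> ('a \<Rightarrow> nat) \<Rightarrow> 'a \<Rightarrow> bool" where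
  "solo S T \<phi> x \<longleftrightarrow> x \<in> S \<and> (\<forall>y\<in>T. \<phi> y \<noteq> \<phi> x)"

text \<open>
  These are the conditions that hold throughout the construction of the alignment. The last one is
  not symmetric in the two rows: the pre-alignment places \<open>a\<close> to the right of every \<open>b < a\<close>, but it
  may place \<open>a\<close> to the right of some \<open>b > a\<close>.
\<close>
definition arranged :: "'a set \<Rightarrow> 'a set \<Rightarrow> ('a \<Rightarrow> nat) \<Rightarrow> bool" where
  "arranged U L \<phi> \<longleftrightarrow>
     U \<union> L \<subseteq> P \<and> U \<inter> L = {} \<and> increasing U \<phi> \<and> increasing L \<phi> \<and> gapless (U \<union> L) \<phi> \<and>
     (\<forall>a b. solo U L \<phi> a \<longrightarrow> solo L U \<phi> b \<longrightarrow> \<phi> b < \<phi> a) \<and>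
     (\<forall>a\<in>U. \<forall>b\<in>L. b \<prec> a \<longrightarrow> \<phi> b < \<phi> a)"

lemma asym: "x \<prec> y \<Longrightarrow> \<not> y \<prec> x"
  using irrefl trans by blast

lemma increasing_less: "increasing S \<phi> \<Longrightarrow> x \<in> S \<Longrightarrow> y \<in> S \<Longrightarrow> \<phi> x < \<phi> y \<Longrightarrow> x \<prec> y"
  unfolding increasing_def by (metis less_asym)

lemma increasing_column: "increasing S \<phi> \<Longrightarrow> x \<in> S \<Longrightarrow> y \<in> S \<Longrightarrow> x \<prec> y \<Longrightarrow> \<phi> x < \<phi> y"
  unfolding increasing_def by (metis irrefl asym)

lemma increasing_inj: "increasing S \<phi> \<Longrightarrow> x \<in> S \<Longrightarrow> y \<in> S \<Longrightarrow> \<phi> x = \<phi> y \<Longrightarrow> x = y"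
  unfolding increasing_def by (metis less_irrefl)

lemma increasing_inj_on: "increasing S \<phi> \<Longrightarrow> T \<subseteq> S \<Longrightarrow> inj_on \<phi> T"
  by (meson increasing_inj inj_onI subsetD)

lemma increasing_compare:
  "increasing S \<phi> \<Longrightarrow> x \<in> S \<Longrightarrow> y \<in> S \<Longrightarrow> x \<prec> y \<or> x = y \<or> y \<prec> x"
  unfolding increasing_def by blast

lemma gapless_column:
  assumes "gapless E \<phi>" "x \<in> E" "1 \<le> d" "d \<le> \<phi> x"
  obtains y where "y \<in> E" "\<phi> y = d"
proof -
  have "\<exists>y\<in>E. \<phi> y = d" using assms(4)
  proof (induction rule: inc_induct)
    case base then show ?case using assms(2) by blast
  next
    case (step n)
    then show ?case using assms(1,3) unfolding gapless_def by force
  qed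
  then show thesis using that by blast
qed

section \<open>The invariant of the alignment process\<close>

text \<open>
  An element of \<open>S\<close> is linked if it is reached from a solo element of \<open>S\<close> by a path of the kind that
  forms a block: the next element shares its column with a \<open>y\<close> that is not above the previous one.
\<close>
inductive linked :: "'a set \<Rightarrow> 'a set \<Rightarrow> ('a \<Rightarrow> nat) \<Rightarrow> 'a \<Rightarrow> bool" for S T \<phi> where
  solo: "solo S T \<phi> x \<Longrightarrow> linked S T \<phi> x"
| step: "\<lbrakk>linked S T \<phi> x; y \<in> T; \<phi> y = \<phi> x + 1; \<not> x \<prec> y; x' \<in> S; \<phi> x' = \<phi> y\<rbrakk>
    \<Longrightarrow> linked S T \<phi> x'"

lemma linked_in: "linked S T \<phi> x \<Longrightarrow> x \<in> S"
  by (induction rule: linked.induct) (auto simp: solo_def)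

text \<open>
  What is added to \<open>arranged\<close> concerns the lower row only, because the asymmetric condition in
  \<open>arranged\<close> implies the corresponding properties of the upper row once nothing can move. A solo lower
  element cuts the order between the lower elements on its left and the upper elements on its right;
  and along a path from a solo lower element, an upper \<open>a\<close> in the next column that is not above \<open>b\<close>
  always meets a lower partner there that is not above \<open>a\<close>.
\<close>
definition prealigned :: "'a set \<Rightarrow> 'a set \<Rightarrow> ('a \<Rightarrow> nat) \<Rightarrow> bool" where
  "prealigned U L \<phi> \<longleftrightarrow> arranged U L \<phi> \<and>
     (\<forall>s b a. solo L U \<phi> s \<longrightarrow> b \<in> L \<longrightarrow> a \<in> U \<longrightarrow> \<phi> b < \<phi> s \<longrightarrow> \<phi> s < \<phi> a \<longrightarrow> b \<prec> a) \<and>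
     (\<forall>b a. linked L U \<phi> b \<longrightarrow> a \<in> U \<longrightarrow> \<phi> a = \<phi> b + 1 \<longrightarrow> \<not> b \<prec> a \<longrightarrow>
        (\<exists>b'\<in>L. \<phi> b' = \<phi> a \<and> \<not> a \<prec> b'))"

definition mobile :: "'a set \<Rightarrow> ('a \<Rightarrow> nat) \<Rightarrow> 'a \<Rightarrow> bool" where
  "mobile E \<phi> x \<longleftrightarrow>
     x \<in> E \<and> (\<exists>y\<in>E. \<phi> y = \<phi> x + 1) \<and> (\<forall>y\<in>E. \<phi> y = \<phi> x + 1 \<longrightarrow> \<not> x \<prec> y)"

lemma increasing_move:
  assumes "increasing S \<phi>" "\<And>y. y \<in> S \<Longrightarrow> \<phi> y \<noteq> \<phi> x + 1"
  shows "increasing S (\<phi>(x := \<phi> x + 1))"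
proof (unfold increasing_def, intro ballI impI)
  fix u v assume uv: "u \<in> S" "v \<in> S" "u \<noteq> v"
  have *: "u \<prec> v \<and> \<phi> u < \<phi> v \<or> v \<prec> u \<and> \<phi> v < \<phi> u"
    using assms(1) uv unfolding increasing_def by blast
  have "\<phi> u \<noteq> \<phi> x + 1" "\<phi> v \<noteq> \<phi> x + 1" using assms(2) uv by auto
  with * show "u \<prec> v \<and> (\<phi>(x := \<phi> x + 1)) u < (\<phi>(x := \<phi> x + 1)) v \<or>
      v \<prec> u \<and> (\<phi>(x := \<phi> x + 1)) v < (\<phi>(x := \<phi> x + 1)) u"
    using uv(3) by auto
qed

text \<open>
  The old column of the moving element stays occupied by its partner \<open>y\<close>.
\<close>
lemma gapless_move:
  assumes "gapless E \<phi>" "y \<in> E" "y \<noteq> x" "\<phi> y = \<phi> x"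
  shows "gapless E (\<phi>(x := \<phi> x + 1))"
proof (unfold gapless_def, intro ballI conjI impI)
  fix z assume z: "z \<in> E"
  show "1 \<le> (\<phi>(x := \<phi> x + 1)) z" using assms(1) z unfolding gapless_def by auto
  assume g: "1 < (\<phi>(x := \<phi> x + 1)) z"
  show "\<exists>w\<in>E. (\<phi>(x := \<phi> x + 1)) w + 1 = (\<phi>(x := \<phi> x + 1)) z"
  proof (cases "z = x")
    case True then show ?thesis using assms by (intro bexI[of _ y]) auto
  next
    case False
    then obtain w where w: "w \<in> E" "\<phi> w + 1 = \<phi> z"
      using assms(1) z g unfolding gapless_def by auto
    show ?thesis
    proof (cases "w = x")
      case True then show ?thesis using assms w False by (intro bexI[of _ y]) auto
    next
      case F: False then show ?thesis using w False by (intro bexI[of _ w]) auto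
    qed
  qed
qed

text \<open>
  An upper \<open>a\<close> can only move into the column of a solo \<open>b'\<close>, since a larger upper element would block
  it. As solo lower elements are to the left of solo upper ones, \<open>a\<close> is not solo, so it leaves behind
  a partner \<open>b\<close>, which becomes the new solo element. For the cut at \<open>b\<close>, note that \<open>a\<close> is below neither
  \<open>b\<close> nor \<open>b'\<close>: it is above \<open>b\<close>, or incomparable to \<open>b < b'\<close> and then, by \<open>3 + 1\<close>-freeness, above
  every lower element to the left of \<open>b\<close>. The new path from \<open>b\<close> goes through \<open>a\<close> to \<open>b'\<close> and continues
  as the old path from \<open>b'\<close>.
\<close>
lemma move_upper:
  assumes pre: "prealigned U L \<phi>" and mob: "mobile (U \<union> L) \<phi> a" and a: "a \<in> U"
  shows "prealigned U L (\<phi>(a := \<phi> a + 1))"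
proof -
  let ?\<psi> = "\<phi>(a := \<phi> a + 1)"
  have arr: "arranged U L \<phi>" using pre unfolding prealigned_def by simp
  have sub: "U \<union> L \<subseteq> P" and dis: "U \<inter> L = {}" and inc: "increasing U \<phi>" "increasing L \<phi>"
    and gap: "gapless (U \<union> L) \<phi>"
    and BA: "\<And>a b. solo U L \<phi> a \<Longrightarrow> solo L U \<phi> b \<Longrightarrow> \<phi> b < \<phi> a"
    and ba: "\<And>a b. a \<in> U \<Longrightarrow> b \<in> L \<Longrightarrow> b \<prec> a \<Longrightarrow> \<phi> b < \<phi> a"
    using arr unfolding arranged_def by blast+
  have cut: "\<And>s b a. solo L U \<phi> s \<Longrightarrow> b \<in> L \<Longrightarrow> a \<in> U \<Longrightarrow> \<phi> b < \<phi> s \<Longrightarrow> \<phi> s < \<phi> a \<Longrightarrow> b \<prec> a"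
    using pre unfolding prealigned_def by blast
  have link: "\<And>b a. linked L U \<phi> b \<Longrightarrow> a \<in> U \<Longrightarrow> \<phi> a = \<phi> b + 1 \<Longrightarrow> \<not> b \<prec> a \<Longrightarrow>
        (\<exists>b'\<in>L. \<phi> b' = \<phi> a \<and> \<not> a \<prec> b')"
    using pre unfolding prealigned_def by blast
  have noU: "\<phi> u \<noteq> \<phi> a + 1" if "u \<in> U" for u
    using mob increasing_less[OF inc(1) a that] that unfolding mobile_def by auto
  then obtain b' where b': "b' \<in> L" "\<phi> b' = \<phi> a + 1" "\<not> a \<prec> b'"
    using mob unfolding mobile_def by auto
  have solo_b': "solo L U \<phi> b'" using noU b' unfolding solo_def by auto
  have "\<not> solo U L \<phi> a" using BA[OF _ solo_b'] b'(2) by fastforce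
  then obtain b where b: "b \<in> L" "\<phi> b = \<phi> a" using a unfolding solo_def by auto
  have ab: "a \<noteq> b" "a \<noteq> b'" using a b b' dis by auto
  have notL: "x \<noteq> a" if "x \<in> L" for x using that a dis by auto
  have bb': "b \<prec> b'" using increasing_less[OF inc(2) b(1) b'(1)] b b' by simp
  have nab: "\<not> a \<prec> b" using b'(3) bb' trans by blast
  have soloL: "solo L U ?\<psi> x \<longleftrightarrow> x = b \<or> solo L U \<phi> x \<and> x \<noteq> b'" for x
  proof -
    have "solo L U ?\<psi> b"
      unfolding solo_def using b ab increasing_inj[OF inc(1) _ a] by auto
    moreover have "\<not> solo L U ?\<psi> b'" unfolding solo_def using a b' ab by auto
    moreover have "solo L U ?\<psi> x \<longleftrightarrow> solo L U \<phi> x" if "x \<noteq> b" "x \<noteq> b'"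
    proof (cases "x \<in> L")
      case True
      then have "\<phi> x \<noteq> \<phi> a" "\<phi> x \<noteq> \<phi> a + 1"
        using increasing_inj[OF inc(2)] that b b' by metis+
      then show ?thesis unfolding solo_def using notL[OF True] True by auto
    qed (simp add: solo_def)
    ultimately show ?thesis using bb' irrefl by blast
  qed
  have soloU: "solo U L \<phi> x" if "solo U L ?\<psi> x" for x
  proof -
    have "x \<noteq> a" using that b' ab unfolding solo_def by auto
    then show ?thesis using that notL unfolding solo_def by auto
  qed
  have left: "y \<prec> a" if "y \<in> L" "\<phi> y < \<phi> a" for y
  proof -
    have yb: "y \<prec> b" using increasing_less[OF inc(2) that(1) b(1)] that b by simp
    show ?thesis
    proof (rule ccontr)
      assume n: "\<not> y \<prec> a"
      have "\<not> b \<prec> a" using n yb trans by blast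
      moreover have "\<not> b' \<prec> a" using \<open>\<not> b \<prec> a\<close> bb' trans by blast
      moreover have "\<not> a \<prec> y" using nab yb trans by blast
      moreover have "y \<in> P" "b \<in> P" "b' \<in> P" "a \<in> P" using sub a b b' that by auto
      ultimately show False using free[of y b b' a] yb bb' n nab b'(3) by blast
    qed
  qed
  have "gapless (U \<union> L) ?\<psi>" using gapless_move[OF gap, of b a] b ab by simp
  moreover have "increasing U ?\<psi>" using increasing_move[OF inc(1)] noU by blast
  moreover have "increasing L ?\<psi>" using inc(2) notL unfolding increasing_def by auto
  moreover have "?\<psi> y < ?\<psi> x" if "solo U L ?\<psi> x" "solo L U ?\<psi> y" for x y
  proof -
    have x: "solo U L \<phi> x" "x \<noteq> a" using soloU that(1) b' ab unfolding solo_def by auto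
    have "\<phi> y < \<phi> x"
      using that(2) BA[OF x(1)] solo_b' b b' unfolding soloL by fastforce
    moreover have "y \<noteq> a" using that(2) notL unfolding solo_def by auto
    ultimately show ?thesis using x by simp
  qed
  moreover have "?\<psi> y < ?\<psi> x" if "x \<in> U" "y \<in> L" "y \<prec> x" for x y
    using ba[OF that] notL[OF that(2)] by auto
  ultimately have arr': "arranged U L ?\<psi>" using sub dis unfolding arranged_def by blast
  have cut': "y \<prec> x" if s: "solo L U ?\<psi> s" and yx: "y \<in> L" "x \<in> U" "?\<psi> y < ?\<psi> s" "?\<psi> s < ?\<psi> x"
    for s y x
  proof -
    have sL: "s \<in> L" using s unfolding solo_def by simp
    have ys: "\<phi> y < \<phi> s" using yx notL sL by auto
    show ?thesis
    proof (cases "s = b")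
      case True
      then have "y \<prec> a" using left yx ys b by simp
      moreover have "x = a \<or> a \<prec> x"
        using yx True b notL[OF b(1)] increasing_less[OF inc(1) a yx(2)] by (auto split: if_splits)
      ultimately show ?thesis using trans by blast
    next
      case False
      then have s': "solo L U \<phi> s" using s soloL by blast
      then have "\<phi> s \<noteq> \<phi> a" using a unfolding solo_def by auto
      then have "\<phi> s < \<phi> x" using yx notL[OF sL] by (auto split: if_splits)
      then show ?thesis using cut[OF s' yx(1,2) ys] by simp
    qed
  qed
  have linked: "linked L U \<phi> x \<or> x = b" if "linked L U ?\<psi> x" for x
    using that
  proof (induction rule: linked.induct)
    case (solo x) then show ?case using soloL linked.solo by blast
  next
    case (step x y x')
    have xL: "x \<in> L" using step(1) linked_in by blast
    have e: "?\<psi> x = \<phi> x" "?\<psi> x' = \<phi> x'" using notL xL step by auto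
    show ?case
    proof (cases "y = a")
      case True
      then have "\<phi> x' = \<phi> b'" using e(2) b'(2) \<open>?\<psi> x' = ?\<psi> y\<close> by (metis fun_upd_same)
      then show ?thesis using increasing_inj[OF inc(2)] step b' solo_b' linked.solo by blast
    next
      case False
      have "x \<noteq> b" using False step e b noU by auto
      then have "linked L U \<phi> x" using step by blast
      then show ?thesis using linked.step[of L U \<phi> x y x'] step e False by auto
    qed
  qed
  have link': "\<exists>z\<in>L. ?\<psi> z = ?\<psi> x \<and> \<not> x \<prec> z"
    if y: "linked L U ?\<psi> y" and x: "x \<in> U" "?\<psi> x = ?\<psi> y + 1" "\<not> y \<prec> x" for y x
  proof (cases "x = a")
    case True then show ?thesis using b' ab by auto
  next
    case False
    have yL: "y \<in> L" using y linked_in by blast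
    have e: "\<phi> x = \<phi> y + 1" using x False notL[OF yL] by simp
    then have "y \<noteq> b" using noU x b by auto
    then have "linked L U \<phi> y" using linked y by blast
    from link[OF this x(1) e x(3)] show ?thesis using notL False by auto
  qed
  show ?thesis unfolding prealigned_def using arr' cut' link' by blast
qed

text \<open>
  A lower \<open>b\<close> can only move into the column of a solo \<open>a'\<close> that is not above \<open>b\<close>. If \<open>b\<close> were linked,
  the invariant would provide a lower element in that column; so \<open>b\<close> is not linked, in particular not
  solo. Its former partner becomes a new solo upper element, about which the invariant demands only
  that it lies to the right of the solo lower ones. No path from a solo lower element uses \<open>b\<close>.
\<close>
lemma move_lower:
  assumes pre: "prealigned U L \<phi>" and mob: "mobile (U \<union> L) \<phi> b" and b: "b \<in> L"
  shows "prealigned U L (\<phi>(b := \<phi> b + 1))"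
proof -
  let ?\<psi> = "\<phi>(b := \<phi> b + 1)"
  have arr: "arranged U L \<phi>" using pre unfolding prealigned_def by simp
  have sub: "U \<union> L \<subseteq> P" and dis: "U \<inter> L = {}" and inc: "increasing U \<phi>" "increasing L \<phi>"
    and gap: "gapless (U \<union> L) \<phi>"
    and BA: "\<And>a b. solo U L \<phi> a \<Longrightarrow> solo L U \<phi> b \<Longrightarrow> \<phi> b < \<phi> a"
    and ba: "\<And>a b. a \<in> U \<Longrightarrow> b \<in> L \<Longrightarrow> b \<prec> a \<Longrightarrow> \<phi> b < \<phi> a"
    using arr unfolding arranged_def by blast+
  have cut: "\<And>s b a. solo L U \<phi> s \<Longrightarrow> b \<in> L \<Longrightarrow> a \<in> U \<Longrightarrow> \<phi> b < \<phi> s \<Longrightarrow> \<phi> s < \<phi> a \<Longrightarrow> b \<prec> a"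
    using pre unfolding prealigned_def by blast
  have link: "\<And>b a. linked L U \<phi> b \<Longrightarrow> a \<in> U \<Longrightarrow> \<phi> a = \<phi> b + 1 \<Longrightarrow> \<not> b \<prec> a \<Longrightarrow>
        (\<exists>b'\<in>L. \<phi> b' = \<phi> a \<and> \<not> a \<prec> b')"
    using pre unfolding prealigned_def by blast
  have noL: "\<phi> u \<noteq> \<phi> b + 1" if "u \<in> L" for u
    using mob increasing_less[OF inc(2) b that] that unfolding mobile_def by auto
  then obtain a' where a': "a' \<in> U" "\<phi> a' = \<phi> b + 1" "\<not> b \<prec> a'"
    using mob unfolding mobile_def by auto
  have not_linked: "\<not> linked L U \<phi> b" using link[OF _ a'] noL a' by metis
  then have "\<not> solo L U \<phi> b" using linked.solo by blast
  then obtain a where a: "a \<in> U" "\<phi> a = \<phi> b" using b unfolding solo_def by auto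
  have ab: "a \<noteq> b" "a' \<noteq> b" using a b a' dis by auto
  have notU: "x \<noteq> b" if "x \<in> U" for x using that b dis by auto
  have soloL: "solo L U \<phi> x \<and> x \<noteq> b \<and> \<phi> x \<noteq> \<phi> b" if "solo L U ?\<psi> x" for x
  proof -
    have "x \<noteq> b" using that a' ab unfolding solo_def by auto
    moreover have "x \<in> L" using that unfolding solo_def by simp
    ultimately have "\<phi> x \<noteq> \<phi> b" using increasing_inj[OF inc(2) _ b] by blast
    moreover have "\<phi> y \<noteq> \<phi> x" if "y \<in> U" for y
      using \<open>solo L U ?\<psi> x\<close> \<open>x \<noteq> b\<close> notU[OF that] that unfolding solo_def by auto
    ultimately show ?thesis using \<open>x \<in> L\<close> \<open>x \<noteq> b\<close> unfolding solo_def by blast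
  qed
  have soloU: "x = a \<or> solo U L \<phi> x" if "solo U L ?\<psi> x" for x
  proof (cases "\<phi> x = \<phi> b")
    case True
    moreover have "x \<in> U" using that unfolding solo_def by simp
    ultimately show ?thesis using increasing_inj[OF inc(1) _ a(1)] a by metis
  next
    case False
    have "\<phi> y \<noteq> \<phi> x" if "y \<in> L" for y
      using \<open>solo U L ?\<psi> x\<close> False notU that unfolding solo_def by (cases "y = b") auto
    then show ?thesis using that unfolding solo_def by blast
  qed
  have "gapless (U \<union> L) ?\<psi>" using gapless_move[OF gap, of a b] a ab by simp
  moreover have "increasing L ?\<psi>" using increasing_move[OF inc(2)] noL by blast
  moreover have "increasing U ?\<psi>" using inc(1) notU unfolding increasing_def by auto
  moreover have "?\<psi> y < ?\<psi> x" if "solo U L ?\<psi> x" "solo L U ?\<psi> y" for x y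
  proof -
    have y: "solo L U \<phi> y" "y \<noteq> b" "\<phi> y \<noteq> \<phi> b" using soloL that(2) by auto
    have x: "x \<noteq> b" using that(1) notU unfolding solo_def by auto
    have "\<phi> y < \<phi> x"
    proof (cases "x = a")
      case True
      have "solo U L \<phi> a'" using a' noL unfolding solo_def by auto
      then have "\<phi> y < \<phi> a'" using BA y by blast
      then show ?thesis using True a a' y by simp
    next
      case False
      then show ?thesis using soloU[OF that(1)] BA y by blast
    qed
    then show ?thesis using x y by simp
  qed
  moreover have "?\<psi> y < ?\<psi> x" if "x \<in> U" "y \<in> L" "y \<prec> x" for x y
  proof (cases "y = b")
    case True
    have "\<phi> b < \<phi> x" using ba[OF that] True by simp
    moreover have "\<phi> x \<noteq> \<phi> b + 1"
      using increasing_inj[OF inc(1) that(1) a'(1)] a' that True by auto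
    ultimately show ?thesis using True notU[OF that(1)] by auto
  next
    case False
    then show ?thesis using ba[OF that] notU[OF that(1)] by auto
  qed
  ultimately have arr': "arranged U L ?\<psi>" using sub dis unfolding arranged_def by blast
  have cut': "y \<prec> x" if s: "solo L U ?\<psi> s" and yx: "y \<in> L" "x \<in> U" "?\<psi> y < ?\<psi> s" "?\<psi> s < ?\<psi> x"
    for s y x
  proof -
    have "solo L U \<phi> s" "s \<noteq> b" using soloL s by auto
    moreover have "\<phi> y < \<phi> s" "\<phi> s < \<phi> x"
      using yx notU[OF yx(2)] \<open>s \<noteq> b\<close> by (auto split: if_splits)
    ultimately show ?thesis using cut yx by blast
  qed
  have linked: "linked L U \<phi> x \<and> x \<noteq> b" if "linked L U ?\<psi> x" for x
    using that
  proof (induction rule: linked.induct)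
    case (solo x) then show ?case using soloL linked.solo by blast
  next
    case (step x y x')
    have x: "x \<in> L" "x \<noteq> b" "linked L U \<phi> x" using step linked_in by blast+
    have y: "y \<noteq> b" using notU step by auto
    have "x' \<noteq> b"
    proof
      assume "x' = b"
      then have "\<phi> x = \<phi> b" using step x y by auto
      then show False using increasing_inj[OF inc(2) x(1) b] x by blast
    qed
    then show ?case using linked.step[of L U \<phi> x y x'] step x y by auto
  qed
  have link': "\<exists>z\<in>L. ?\<psi> z = ?\<psi> x \<and> \<not> x \<prec> z"
    if y: "linked L U ?\<psi> y" and x: "x \<in> U" "?\<psi> x = ?\<psi> y + 1" "\<not> y \<prec> x" for y x
  proof -
    have y': "linked L U \<phi> y" "y \<noteq> b" using linked y by auto
    have e: "\<phi> x = \<phi> y + 1" using x notU[OF x(1)] y' by simp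
    from link[OF y'(1) x(1) e x(3)] obtain z where z: "z \<in> L" "\<phi> z = \<phi> x" "\<not> x \<prec> z" by blast
    have "z \<noteq> b" using not_linked linked.step[OF y'(1) x(1) e x(3) z(1,2)] by blast
    then show ?thesis using z notU[OF x(1)] by auto
  qed
  show ?thesis unfolding prealigned_def using arr' cut' link' by blast
qed

lemma prealigned_move:
  "prealigned U L \<phi> \<Longrightarrow> mobile (U \<union> L) \<phi> x \<Longrightarrow> prealigned U L (\<phi>(x := \<phi> x + 1))"
  using move_upper move_lower unfolding mobile_def by blast

section \<open>Blocks of solo elements\<close>

text \<open>
  The elements \<open>f 0, \<dots>, f t\<close> are \<open>x\<^sub>0, \<dots>, x\<^sub>t\<close>, and \<open>g k\<close> is \<open>y\<^sub>k\<^sub>+\<^sub>1\<close>. The definition mentions only the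
  union \<open>E\<close> of the two rows, so that a block remains a block when elements change rows inside their
  columns.
\<close>
definition block ::
    "'a set \<Rightarrow> ('a \<Rightarrow> nat) \<Rightarrow> nat \<Rightarrow> (nat \<Rightarrow> 'a) \<Rightarrow> (nat \<Rightarrow> 'a) \<Rightarrow> bool" where
  "block E \<phi> t f g \<longleftrightarrow>
     (\<forall>x\<in>E. \<phi> x = \<phi> (f 0) \<longrightarrow> x = f 0) \<and>
     (\<forall>k\<le>t. f k \<in> E \<and> \<phi> (f k) = \<phi> (f 0) + k) \<and>
     (\<forall>k<t. f k \<prec> f (Suc k)) \<and>
     (\<forall>k<t. g k \<in> E \<and> \<phi> (g k) = \<phi> (f 0) + Suc k \<and>
        \<not> g k \<prec> f k \<and> \<not> f k \<prec> g k \<and> \<not> g k \<prec> f (Suc k) \<and> \<not> f (Suc k) \<prec> g k) \<and>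
     (\<forall>x\<in>E. \<forall>y\<in>E. \<phi> x < \<phi> (f 0) \<longrightarrow> \<phi> (f 0) \<le> \<phi> y \<longrightarrow> x \<prec> y) \<and>
     (\<forall>x\<in>E. \<forall>y\<in>E. \<phi> x \<le> \<phi> (f 0) + t \<longrightarrow> \<phi> (f 0) + t < \<phi> y \<longrightarrow> x \<prec> y)"

definition aligned :: "'a set \<Rightarrow> 'a set \<Rightarrow> ('a \<Rightarrow> nat) \<Rightarrow> bool" where
  "aligned U L \<phi> \<longleftrightarrow> arranged U L \<phi> \<and>
     (\<forall>x. solo U L \<phi> x \<or> solo L U \<phi> x \<longrightarrow> (\<exists>t f g. f 0 = x \<and> block (U \<union> L) \<phi> t f g))"

lemma blockD:
  assumes "block E \<phi> t f g"
  shows block_start: "x \<in> E \<Longrightarrow> \<phi> x = \<phi> (f 0) \<Longrightarrow> x = f 0"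
    and block_f: "k \<le> t \<Longrightarrow> f k \<in> E" "k \<le> t \<Longrightarrow> \<phi> (f k) = \<phi> (f 0) + k"
    and block_less: "k < t \<Longrightarrow> f k \<prec> f (Suc k)"
    and block_g: "k < t \<Longrightarrow> g k \<in> E" "k < t \<Longrightarrow> \<phi> (g k) = \<phi> (f 0) + Suc k"
    and block_fg: "k < t \<Longrightarrow> \<not> g k \<prec> f k" "k < t \<Longrightarrow> \<not> f k \<prec> g k"
      "k < t \<Longrightarrow> \<not> g k \<prec> f (Suc k)" "k < t \<Longrightarrow> \<not> f (Suc k) \<prec> g k"
    and block_left: "x \<in> E \<Longrightarrow> y \<in> E \<Longrightarrow> \<phi> x < \<phi> (f 0) \<Longrightarrow> \<phi> (f 0) \<le> \<phi> y \<Longrightarrow> x \<prec> y"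
    and block_right:
      "x \<in> E \<Longrightarrow> y \<in> E \<Longrightarrow> \<phi> x \<le> \<phi> (f 0) + t \<Longrightarrow> \<phi> (f 0) + t < \<phi> y \<Longrightarrow> x \<prec> y"
  using assms unfolding block_def by blast+

lemma aligned_block:
  assumes "aligned U L \<phi>" "solo U L \<phi> x \<or> solo L U \<phi> x"
  obtains t f g where "f 0 = x" "block (U \<union> L) \<phi> t f g"
proof -
  have "\<exists>t f g. f 0 = x \<and> block (U \<union> L) \<phi> t f g" 
    using conjunct2[OF assms(1)[unfolded aligned_def], rule_format, OF assms(2)] .
  then show thesis using that by (elim exE conjE)
qed

text \<open>
  When nothing can move, every element has a larger one in the next column; the chain that starts in
  \<open>x\<close> has to pass through \<open>s\<close>.
\<close>
lemma left_of_solo: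
  assumes gap: "gapless E \<phi>" and still: "\<And>x. \<not> mobile E \<phi> x"
    and s: "s \<in> E" "\<And>y. y \<in> E \<Longrightarrow> \<phi> y = \<phi> s \<Longrightarrow> y = s"
    and x: "x \<in> E" "\<phi> x < \<phi> s"
  shows "x \<prec> s"
  using x
proof (induction "\<phi> s - \<phi> x" arbitrary: x rule: less_induct)
  case less
  have "\<exists>y\<in>E. \<phi> y = \<phi> x + 1"
    using gapless_column[OF gap s(1), of "\<phi> x + 1"] less(3) by auto
  then obtain y where y: "y \<in> E" "\<phi> y = \<phi> x + 1" "x \<prec> y"
    using still[of x] less(2) unfolding mobile_def by blast
  show ?case
  proof (cases "\<phi> y = \<phi> s")
    case True then show ?thesis using s y by blast
  next
    case False
    then have "y \<prec> s" using less(1)[of y] y less(3) by auto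
    then show ?thesis using y trans by blast
  qed
qed

lemma solo_unique:
  "increasing S \<phi> \<Longrightarrow> solo S T \<phi> s \<Longrightarrow> y \<in> S \<union> T \<Longrightarrow> \<phi> y = \<phi> s \<Longrightarrow> y = s"
  unfolding solo_def using increasing_inj by blast

text \<open>
  The only case that is not immediate from \<open>left_of_solo\<close> and the cut in the invariant is \<open>x\<close> upper, \<open>y\<close>
  lower and \<open>s\<close> upper. Since \<open>y\<close> is to the right of a solo upper element, it has an upper partner \<open>a\<close>. If \<open>x\<close> were not
  below \<open>y\<close>, then \<open>y\<close> would be incomparable to each member of the chain \<open>x < s < a\<close>.
\<close>
lemma solo_cut:
  assumes pre: "prealigned U L \<phi>" and still: "\<And>x. \<not> mobile (U \<union> L) \<phi> x"
    and s: "solo U L \<phi> s \<or> solo L U \<phi> s"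
    and x: "x \<in> U \<union> L" "\<phi> x < \<phi> s" and y: "y \<in> U \<union> L" "\<phi> s \<le> \<phi> y"
  shows "x \<prec> y"
proof -
  have arr: "arranged U L \<phi>" using pre unfolding prealigned_def by simp
  have sub: "U \<union> L \<subseteq> P" and dis: "U \<inter> L = {}" and inc: "increasing U \<phi>" "increasing L \<phi>"
    and gap: "gapless (U \<union> L) \<phi>"
    and BA: "\<And>a b. solo U L \<phi> a \<Longrightarrow> solo L U \<phi> b \<Longrightarrow> \<phi> b < \<phi> a"
    and ba: "\<And>a b. a \<in> U \<Longrightarrow> b \<in> L \<Longrightarrow> b \<prec> a \<Longrightarrow> \<phi> b < \<phi> a"
    using arr unfolding arranged_def by blast+
  have cut: "\<And>s b a. solo L U \<phi> s \<Longrightarrow> b \<in> L \<Longrightarrow> a \<in> U \<Longrightarrow> \<phi> b < \<phi> s \<Longrightarrow> \<phi> s < \<phi> a \<Longrightarrow> b \<prec> a"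
    using pre unfolding prealigned_def by blast
  have uniq: "z = s" if "z \<in> U \<union> L" "\<phi> z = \<phi> s" for z
    using s solo_unique[OF inc(1), of L s z] solo_unique[OF inc(2), of U s z] that by blast
  have sE: "s \<in> U \<union> L" using s unfolding solo_def by blast
  have xs: "x \<prec> s" using left_of_solo[OF gap still sE] uniq x by blast
  have row: ?thesis if "x \<in> S" "y \<in> S" "increasing S \<phi>" for S
    using increasing_less[OF that(3,1,2)] x y by simp
  have same: ?thesis if "s \<in> S" "y \<in> S" "increasing S \<phi>" for S
  proof -
    have "y = s \<or> s \<prec> y"
      using increasing_less[OF that(3,1,2)] uniq[OF y(1)] y(2) by fastforce
    then show ?thesis using xs trans by blast
  qed
  consider "x \<in> U \<and> y \<in> U \<or> x \<in> L \<and> y \<in> L" | "x \<in> L" "y \<in> U" | "x \<in> U" "y \<in> L"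
    using x y by blast
  then show ?thesis
  proof cases
    case 1 then show ?thesis using row inc by blast
  next
    case 2
    show ?thesis
    proof (cases "s \<in> U")
      case True then show ?thesis using same 2 inc by blast
    next
      case False
      then have "solo L U \<phi> s" using s unfolding solo_def by blast
      moreover have "\<phi> y \<noteq> \<phi> s" using uniq[OF y(1)] 2 False by blast
      ultimately show ?thesis using cut 2 x y by simp
    qed
  next
    case 3
    show ?thesis
    proof (cases "s \<in> L")
      case True then show ?thesis using same 3 inc by blast
    next
      case False
      then have sU: "solo U L \<phi> s" "s \<in> U" using s unfolding solo_def by blast+
      have sy: "\<phi> s < \<phi> y" using uniq[OF y(1)] 3 False y(2) by fastforce
      show ?thesis
      proof (rule ccontr)
        assume n: "\<not> x \<prec> y"
        have "\<not> solo L U \<phi> y" using BA[OF sU(1)] sy by fastforce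
        then obtain a where a: "a \<in> U" "\<phi> a = \<phi> y" using 3 unfolding solo_def by auto
        have sa: "s \<prec> a" using increasing_less[OF inc(1) sU(2) a(1)] a sy by simp
        have "\<not> y \<prec> x" using ba[OF 3(1,2)] x sy by auto
        moreover have "\<not> s \<prec> y" using n xs trans by blast
        moreover have "\<not> y \<prec> s" using ba[OF sU(2) 3(2)] sy by auto
        moreover have "\<not> y \<prec> a" using ba[OF a(1) 3(2)] a by auto
        moreover have "\<not> a \<prec> y" using \<open>\<not> s \<prec> y\<close> sa trans by blast
        moreover have "x \<in> P" "s \<in> P" "a \<in> P" "y \<in> P" using sub 3 sU a by auto
        ultimately show False using free[of x s a y] xs sa n by blast
      qed
    qed
  qed
qed

text \<open>
  Follow the path from \<open>s\<close> until the element of \<open>T\<close> in the next column, if any, is above the current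
  \<open>f k\<close>. Whenever the path goes on, immobility of \<open>f k\<close> yields an element of \<open>S\<close> in the next column,
  and the hypothesis on linked elements yields the incomparabilities. The rows are arbitrary here, so
  that the lemma applies to solo elements of either row.
\<close>
lemma block_exists:
  assumes inc: "increasing S \<phi>" "increasing T \<phi>" and dis: "S \<inter> T = {}" and sub: "S \<union> T \<subseteq> P"
    and gap: "gapless (S \<union> T) \<phi>" and still: "\<And>x. \<not> mobile (S \<union> T) \<phi> x"
    and s: "solo S T \<phi> s"
    and cut: "\<And>s x y. solo S T \<phi> s \<Longrightarrow> x \<in> S \<union> T \<Longrightarrow> \<phi> x < \<phi> s \<Longrightarrow>
       y \<in> S \<union> T \<Longrightarrow> \<phi> s \<le> \<phi> y \<Longrightarrow> x \<prec> y"
    and link: "\<And>x y x'. linked S T \<phi> x \<Longrightarrow> y \<in> T \<Longrightarrow> \<phi> y = \<phi> x + 1 \<Longrightarrow> \<not> x \<prec> y \<Longrightarrow>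
       x' \<in> S \<Longrightarrow> \<phi> x' = \<phi> y \<Longrightarrow> \<not> y \<prec> x \<and> \<not> y \<prec> x' \<and> \<not> x' \<prec> y"
  shows "\<exists>t f g. f 0 = s \<and> block (S \<union> T) \<phi> t f g"
proof -
  define c where "c = \<phi> s"
  define f where "f k = (SOME x. x \<in> S \<and> \<phi> x = c + k)" for k
  define g where "g k = (SOME y. y \<in> T \<and> \<phi> y = c + Suc k)" for k
  have f: "f k = x" if "x \<in> S" "\<phi> x = c + k" for x k
    unfolding f_def by (rule some_equality) (use that increasing_inj[OF inc(1)] in auto)
  have g: "g k = x" if "x \<in> T" "\<phi> x = c + Suc k" for x k
    unfolding g_def by (rule some_equality) (use that increasing_inj[OF inc(2)] in auto)
  have sS: "s \<in> S" using s unfolding solo_def by simp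
  have f0: "f 0 = s" using f[of s 0] sS c_def by simp
  define goes where "goes k \<longleftrightarrow> (\<exists>y\<in>T. \<phi> y = c + Suc k \<and> \<not> f k \<prec> y)" for k
  have fin: "finite (S \<union> T)" using finite_subset[OF sub finite_P] .
  have "\<exists>k. \<not> goes k"
  proof (rule ccontr)
    assume "\<nexists>k. \<not> goes k"
    then have "goes (Max (\<phi> ` (S \<union> T)))" by blast
    then obtain y where "y \<in> T" "\<phi> y > Max (\<phi> ` (S \<union> T))" unfolding goes_def by auto
    then show False using Max_ge[of "\<phi> ` (S \<union> T)" "\<phi> y"] fin by (simp add: leD)
  qed
  define t where "t = (LEAST k. \<not> goes k)"
  have ends: "\<not> goes t" unfolding t_def using \<open>\<exists>k. \<not> goes k\<close> by (rule LeastI_ex)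
  have goes: "goes k" if "k < t" for k using not_less_Least that unfolding t_def by blast
  have step: "f k \<in> S \<and> \<phi> (f k) = c + k \<and> linked S T \<phi> (f k)" if "k \<le> t" for k
    using that
  proof (induction k)
    case 0 then show ?case using f0 sS c_def linked.solo[OF s] by simp
  next
    case (Suc k)
    then have k: "f k \<in> S" "\<phi> (f k) = c + k" "linked S T \<phi> (f k)" by auto
    obtain y where y: "y \<in> T" "\<phi> y = c + Suc k" "\<not> f k \<prec> y"
      using goes[of k] Suc unfolding goes_def by auto
    obtain x where x: "x \<in> S \<union> T" "\<phi> x = c + Suc k" "f k \<prec> x"
    proof -
      have "\<exists>y\<in>S \<union> T. \<phi> y = \<phi> (f k) + 1" using k(2) y by (intro bexI[of _ y]) auto
      then show thesis using still[of "f k"] k(1,2) that unfolding mobile_def by force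
    qed
    then have xS: "x \<in> S" using increasing_inj[OF inc(2) _ y(1)] y by fastforce
    then have "f (Suc k) = x" using f x by blast
    then show ?case using xS x linked.step[OF k(3) y(1) _ y(3) xS] k y by simp
  qed
  have gk: "g k \<in> T \<and> \<phi> (g k) = c + Suc k \<and> \<not> g k \<prec> f k \<and> \<not> f k \<prec> g k \<and>
      \<not> g k \<prec> f (Suc k) \<and> \<not> f (Suc k) \<prec> g k" if "k < t" for k
  proof -
    obtain y where y: "y \<in> T" "\<phi> y = c + Suc k" "\<not> f k \<prec> y"
      using goes[OF \<open>k < t\<close>] unfolding goes_def by auto
    have "g k = y" using g y by blast
    moreover have "f k \<in> S" "\<phi> (f k) = c + k" "linked S T \<phi> (f k)" using step[of k] that by auto
    moreover have "f (Suc k) \<in> S" "\<phi> (f (Suc k)) = c + Suc k" using step[of "Suc k"] that by auto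
    ultimately show ?thesis using link[of "f k" y "f (Suc k)"] y by simp
  qed
  have mono: "f i = f j \<or> f i \<prec> f j" if "i \<le> j" "j \<le> t" for i j
    using increasing_less[OF inc(1), of "f i" "f j"] step[of i] step[of j] that
    by (cases "i = j") simp_all
  have uniq: "x = s" if "x \<in> S \<union> T" "\<phi> x = \<phi> s" for x
    using solo_unique[OF inc(1) s that] .
  have end_S: "f t \<prec> y" if "y \<in> S" "c + t < \<phi> y" for y
    using increasing_less[OF inc(1), of "f t" y] step[of t] that by simp
  have right: "x \<prec> y" if x: "x \<in> S \<union> T" "\<phi> x \<le> c + t" and y: "y \<in> S \<union> T" "c + t < \<phi> y" for x y
  proof (cases "\<phi> x < c")
    case True
    then show ?thesis using cut[OF s x(1) _ y(1)] y c_def by simp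
  next
    case False
    define k where "k = \<phi> x - c"
    have k: "\<phi> x = c + k" "k \<le> t" using False x k_def by auto
    have xf: "x = f k" if "x \<in> S" using f k that by metis
    have xg: "0 < k \<and> x = g (k - 1)" if "x \<in> T"
    proof -
      have "x \<noteq> s" using that sS dis by blast
      then have "k \<noteq> 0" using uniq[OF x(1)] k c_def by auto
      then show ?thesis using g[of x "k - 1"] k that by simp
    qed
    consider "x \<in> S \<and> y \<in> S \<or> x \<in> T \<and> y \<in> T" | "x \<in> S" "y \<in> T" | "x \<in> T" "y \<in> S"
      using x y by blast
    then show ?thesis
    proof cases
      case 1
      then show ?thesis using increasing_less[OF inc(1), of x y] increasing_less[OF inc(2), of x y]
          x y by auto
    next
      case 2
      have xt: "x = f t \<or> x \<prec> f t" using mono[of k t] k xf 2 by auto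
      show ?thesis
      proof (cases "\<exists>z\<in>T. \<phi> z = c + Suc t")
        case True
        then obtain z where z: "z \<in> T" "\<phi> z = c + Suc t" by blast
        then have "f t \<prec> z" using ends unfolding goes_def by blast
        moreover have "z = y \<or> z \<prec> y"
          using increasing_less[OF inc(2) z(1) 2(2)] increasing_inj[OF inc(2) z(1) 2(2)] z y
          by linarith
        ultimately show ?thesis using xt trans by blast
      next
        case F: False
        obtain z where z: "z \<in> S \<union> T" "\<phi> z = c + Suc t"
          using gapless_column[OF gap y(1), of "c + Suc t"] y by auto
        then have "solo S T \<phi> z" using F unfolding solo_def by auto
        from cut[OF this x(1) _ y(1)] show ?thesis using z x y by simp
      qed
    next
      case 3
      then have k0: "0 < k" "x = g (k - 1)" using xg by auto
      define h where "h = t - 1"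
      have h: "h < t" "t = Suc h" using k0 k h_def by auto
      have gh: "g h \<in> T" "\<phi> (g h) = c + t" "\<not> g h \<prec> f h" "\<not> f h \<prec> g h"
        "\<not> g h \<prec> f t" "\<not> f t \<prec> g h"
        using gk[OF h(1)] h(2) by auto
      have "x = g h \<or> x \<prec> g h"
        using increasing_less[OF inc(2) 3(1) gh(1)] increasing_inj[OF inc(2) 3(1) gh(1)] gh(2) k
        by linarith
      moreover have "g h \<prec> y"
      proof -
        have fy: "f t \<prec> y" using end_S 3 y by blast
        have ff: "f h \<prec> f t" using increasing_less[OF inc(1)] step[of h] step[of t] h by auto
        have "\<not> y \<prec> g h" using fy gh trans by blast
        moreover have "f h \<in> P" "f t \<in> P" "y \<in> P" "g h \<in> P"
          using sub step[of h] step[of t] 3 gh h by auto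
        ultimately show ?thesis using free[of "f h" "f t" y "g h"] fy ff gh by blast
      qed
      ultimately show ?thesis using trans by blast
    qed
  qed
  have "block (S \<union> T) \<phi> t f g"
    unfolding block_def f0
  proof (intro conjI)
    show "\<forall>x\<in>S \<union> T. \<phi> x = \<phi> s \<longrightarrow> x = s" using uniq by blast
    show "\<forall>k\<le>t. f k \<in> S \<union> T \<and> \<phi> (f k) = \<phi> s + k" using step c_def by auto
    show "\<forall>k<t. f k \<prec> f (Suc k)"
    proof (intro allI impI)
      fix k assume "k < t"
      then show "f k \<prec> f (Suc k)"
        using increasing_less[OF inc(1), of "f k" "f (Suc k)"] step[of k] step[of "Suc k"] by simp
    qed
    show "\<forall>k<t. g k \<in> S \<union> T \<and> \<phi> (g k) = \<phi> s + Suc k \<and>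
      \<not> g k \<prec> f k \<and> \<not> f k \<prec> g k \<and> \<not> g k \<prec> f (Suc k) \<and> \<not> f (Suc k) \<prec> g k"
      using gk c_def by auto
    show "\<forall>x\<in>S \<union> T. \<forall>y\<in>S \<union> T. \<phi> x < \<phi> s \<longrightarrow> \<phi> s \<le> \<phi> y \<longrightarrow> x \<prec> y"
      using cut[OF s] by blast
    show "\<forall>x\<in>S \<union> T. \<forall>y\<in>S \<union> T. \<phi> x \<le> \<phi> s + t \<longrightarrow> \<phi> s + t < \<phi> y \<longrightarrow> x \<prec> y"
      using right c_def by blast
  qed
  then show ?thesis using f0 by blast
qed

text \<open>
  For a path in the lower row, the incomparabilities come from the invariant. For a path in the upper
  row \<open>x < x'\<close> with \<open>y\<close> in the lower row, the asymmetric condition excludes \<open>y < x'\<close>, and \<open>x' < y\<close>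
  would imply \<open>x < y\<close>.
\<close>
lemma prealigned_imp_aligned:
  assumes pre: "prealigned U L \<phi>" and still: "\<And>x. \<not> mobile (U \<union> L) \<phi> x"
  shows "aligned U L \<phi>"
proof -
  have arr: "arranged U L \<phi>" using pre unfolding prealigned_def by simp
  have sub: "U \<union> L \<subseteq> P" and dis: "U \<inter> L = {}" and inc: "increasing U \<phi>" "increasing L \<phi>"
    and gap: "gapless (U \<union> L) \<phi>"
    and ba: "\<And>a b. a \<in> U \<Longrightarrow> b \<in> L \<Longrightarrow> b \<prec> a \<Longrightarrow> \<phi> b < \<phi> a"
    using arr unfolding arranged_def by blast+
  have link: "\<And>b a. linked L U \<phi> b \<Longrightarrow> a \<in> U \<Longrightarrow> \<phi> a = \<phi> b + 1 \<Longrightarrow> \<not> b \<prec> a \<Longrightarrow>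
        (\<exists>b'\<in>L. \<phi> b' = \<phi> a \<and> \<not> a \<prec> b')"
    using pre unfolding prealigned_def by blast
  have cut: "\<And>s x y. solo U L \<phi> s \<or> solo L U \<phi> s \<Longrightarrow> x \<in> U \<union> L \<Longrightarrow> \<phi> x < \<phi> s \<Longrightarrow>
       y \<in> U \<union> L \<Longrightarrow> \<phi> s \<le> \<phi> y \<Longrightarrow> x \<prec> y"
    using solo_cut[OF pre still] by blast
  have "\<exists>t f g. f 0 = s \<and> block (U \<union> L) \<phi> t f g" if s: "solo U L \<phi> s" for s
  proof (rule block_exists[OF inc dis sub gap still s])
    fix x y x' assume x: "linked U L \<phi> x" and y: "y \<in> L" "\<phi> y = \<phi> x + 1" "\<not> x \<prec> y"
      and x': "x' \<in> U" "\<phi> x' = \<phi> y"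
    have xU: "x \<in> U" using x linked_in by blast
    have "x \<prec> x'" using increasing_less[OF inc(1) xU x'(1)] x' y by simp
    then show "\<not> y \<prec> x \<and> \<not> y \<prec> x' \<and> \<not> x' \<prec> y"
      using ba[OF xU y(1)] ba[OF x'(1) y(1)] y x' trans[of x x' y] by auto
  qed (use cut in blast)
  moreover have "\<exists>t f g. f 0 = s \<and> block (U \<union> L) \<phi> t f g" if s: "solo L U \<phi> s" for s
    unfolding Un_commute[of U L]
  proof (rule block_exists[OF inc(2,1) _ _ _ _ s])
    fix x y x' assume x: "linked L U \<phi> x" and y: "y \<in> U" "\<phi> y = \<phi> x + 1" "\<not> x \<prec> y"
      and x': "x' \<in> L" "\<phi> x' = \<phi> y"
    have xL: "x \<in> L" using x linked_in by blast
    have "x \<prec> x'" using increasing_less[OF inc(2) xL x'(1)] x' y by simp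
    moreover have "\<not> y \<prec> x'"
      using link[OF x y] x' increasing_inj[OF inc(2) x'(1)] by metis
    ultimately show "\<not> y \<prec> x \<and> \<not> y \<prec> x' \<and> \<not> x' \<prec> y"
      using ba[OF y(1) x'(1)] x' trans[of y x x'] by auto
  next
    show "L \<inter> U = {}" "L \<union> U \<subseteq> P" "gapless (L \<union> U) \<phi>"
      using dis sub gap by (simp_all add: Un_commute Int_commute)
    show "\<not> mobile (L \<union> U) \<phi> x" for x using still by (simp add: Un_commute)
    show "x \<prec> y" if "solo L U \<phi> s" "x \<in> L \<union> U" "\<phi> x < \<phi> s" "y \<in> L \<union> U" "\<phi> s \<le> \<phi> y" for s x y
      using cut[of s x y] that by blast
  qed
  ultimately show ?thesis using arr unfolding aligned_def by blast
qed

section \<open>Uniqueness of aligned columns\<close>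
definition agree_below :: "'a set \<Rightarrow> nat \<Rightarrow> ('a \<Rightarrow> nat) \<Rightarrow> ('a \<Rightarrow> nat) \<Rightarrow> bool" where
  "agree_below E c \<phi> \<psi> \<longleftrightarrow> (\<forall>x\<in>E. \<phi> x < c \<or> \<psi> x < c \<longrightarrow> \<phi> x = \<psi> x)"

lemma agree_below_ge: "agree_below E c \<phi> \<psi> \<Longrightarrow> x \<in> E \<Longrightarrow> c \<le> \<phi> x \<longleftrightarrow> c \<le> \<psi> x"
  unfolding agree_below_def by (metis not_less)

text \<open>
  A counting argument. Let \<open>c\<close> be the first column in which the two functions may differ. Everything
  from column \<open>c\<close> on contains more upper than lower elements, as \<open>\<phi>\<close> shows; hence \<open>\<psi>\<close> also has a solo upper
  element in this range. Take the first one, \<open>a\<close>. Under \<open>\<psi>\<close> each column from \<open>c\<close> to the one before \<open>a\<close>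
  contains a lower element below \<open>a\<close>. Under \<open>\<phi>\<close> these are strictly between column \<open>c\<close> and the column
  of \<open>a\<close>, which forces \<open>\<psi> a < \<phi> a\<close>. But under \<open>\<phi>\<close> each column from \<open>c\<close> to the one before \<open>a\<close> contains
  an upper element below \<open>a\<close>, and \<open>\<psi>\<close> has room for these only if \<open>\<phi> a \<le> \<psi> a\<close>.
\<close>
lemma no_lower_at_upper_solo:
  assumes al: "aligned U L \<phi>" "aligned U L \<psi>" and ag: "agree_below (U \<union> L) c \<phi> \<psi>"
    and s: "solo U L \<phi> s" "\<phi> s = c" and b0: "b0 \<in> L" "\<psi> b0 = c"
  shows False
proof -
  have arr: "arranged U L \<phi>" "arranged U L \<psi>" using al unfolding aligned_def by simp_all
  have fin: "finite U" "finite L"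
    using arr(1) finite_subset[OF _ finite_P] unfolding arranged_def by auto
  have inc: "increasing U \<phi>" "increasing L \<phi>" "increasing U \<psi>" "increasing L \<psi>"
    and gap: "gapless (U \<union> L) \<phi>" "gapless (U \<union> L) \<psi>"
    and BA: "\<And>a b. solo U L \<phi> a \<Longrightarrow> solo L U \<phi> b \<Longrightarrow> \<phi> b < \<phi> a"
    and ba: "\<And>a b. a \<in> U \<Longrightarrow> b \<in> L \<Longrightarrow> b \<prec> a \<Longrightarrow> \<phi> b < \<phi> a"
    using arr unfolding arranged_def by blast+
  have ge: "c \<le> \<phi> x \<longleftrightarrow> c \<le> \<psi> x" if "x \<in> U \<union> L" for x
    using agree_below_ge[OF ag that] .
  have sU: "s \<in> U" using s unfolding solo_def by simp
  have c1: "1 \<le> c" using gap(1) sU s(2) unfolding gapless_def by blast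
  have noL: "\<phi> b \<noteq> c" if "b \<in> L" for b using s that unfolding solo_def by auto
  have upper: "\<exists>a\<in>U. \<phi> a = \<phi> x" if "x \<in> U \<union> L" "c \<le> \<phi> x" for x
  proof (cases "x \<in> U")
    case False
    then have "\<not> solo L U \<phi> x" using BA[OF s(1)] s(2) that by fastforce
    then show ?thesis using that False unfolding solo_def by auto
  qed blast
  define RU where "RU = {a\<in>U. c \<le> \<phi> a}"
  define RL where "RL = {b\<in>L. c \<le> \<phi> b}"
  \<comment> \<open>Under \<open>\<phi>\<close>, every column from \<open>c\<close> on holds an upper element, and column \<open>c\<close> no lower one.\<close>
  have "card (\<phi> ` RL) < card (\<phi> ` RU)"
  proof (rule psubset_card_mono)
    have "\<phi> ` RL \<subseteq> \<phi> ` RU"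
    proof
      fix d assume "d \<in> \<phi> ` RL"
      then obtain b where "b \<in> L" "c \<le> \<phi> b" "d = \<phi> b" unfolding RL_def by blast
      then obtain a where "a \<in> U" "\<phi> a = \<phi> b" using upper[of b] by blast
      then show "d \<in> \<phi> ` RU"
        using \<open>c \<le> \<phi> b\<close> \<open>d = \<phi> b\<close> unfolding RU_def by (intro image_eqI[of _ _ a]) auto
    qed
    moreover have "c \<in> \<phi> ` RU" using s sU unfolding RU_def by blast
    moreover have "c \<notin> \<phi> ` RL" using noL unfolding RL_def by blast
    ultimately show "\<phi> ` RL \<subset> \<phi> ` RU" by blast
  qed (use fin RU_def in simp)
  moreover have "card (\<phi> ` RL) = card RL"
    by (rule card_image, rule increasing_inj_on[OF inc(2)]) (auto simp: RL_def)
  moreover have "card (\<phi> ` RU) = card RU"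
    by (rule card_image, rule increasing_inj_on[OF inc(1)]) (auto simp: RU_def)
  moreover have "card (\<psi> ` RL) = card RL"
    by (rule card_image, rule increasing_inj_on[OF inc(4)]) (auto simp: RL_def)
  moreover have "card (\<psi> ` RU) = card RU"
    by (rule card_image, rule increasing_inj_on[OF inc(3)]) (auto simp: RU_def)
  ultimately have "\<not> \<psi> ` RU \<subseteq> \<psi> ` RL"
    using card_mono[of "\<psi> ` RL" "\<psi> ` RU"] fin RL_def by auto
  then obtain a0 where a0: "a0 \<in> U" "c \<le> \<psi> a0" "\<psi> a0 \<notin> \<psi> ` RL"
    using ge unfolding RU_def by auto
  have "solo U L \<psi> a0"
    unfolding solo_def
  proof (intro conjI ballI notI)
    fix b assume b: "b \<in> L" "\<psi> b = \<psi> a0"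
    then have "b \<in> RL" using ge[of b] a0 unfolding RL_def by simp
    then show False using a0(3) b(2) by (metis image_eqI)
  qed (rule a0(1))
  then obtain a where a: "solo U L \<psi> a" "c \<le> \<psi> a"
    and least: "\<And>y. solo U L \<psi> y \<Longrightarrow> c \<le> \<psi> y \<Longrightarrow> \<psi> a \<le> \<psi> y"
    using ex_has_least_nat[of "\<lambda>a. solo U L \<psi> a \<and> c \<le> \<psi> a" a0 \<psi>] a0(2) by blast
  have aU: "a \<in> U" using a unfolding solo_def by simp
  have ca: "c < \<psi> a" using a b0 unfolding solo_def by (metis le_neq_implies_less)
  obtain t f g where blk: "f 0 = a" "block (U \<union> L) \<psi> t f g"
    using aligned_block[OF al(2)] a(1) by blast
  have left: "x \<prec> a" if "x \<in> U \<union> L" "\<psi> x < \<psi> a" for x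
    using block_left[OF blk(2) that(1), of a] blk(1) that(2) aU by simp
  define L1 where "L1 = {b\<in>L. c \<le> \<psi> b \<and> \<psi> b < \<psi> a}"
  define U1 where "U1 = {x\<in>U. c \<le> \<phi> x \<and> \<phi> x < \<phi> a}"
  have "{c..<\<psi> a} \<subseteq> \<psi> ` L1"
  proof
    fix d assume d: "d \<in> {c..<\<psi> a}"
    then obtain y where y: "y \<in> U \<union> L" "\<psi> y = d"
      using gapless_column[OF gap(2), of a d] aU c1 by auto
    have "\<not> solo U L \<psi> y" using least[of y] y d by auto
    then obtain b where "b \<in> L" "\<psi> b = d" using y unfolding solo_def by auto
    then show "d \<in> \<psi> ` L1" using d unfolding L1_def by auto
  qed
  then have "\<psi> a - c \<le> card (\<psi> ` L1)" using card_mono[of "\<psi> ` L1" "{c..<\<psi> a}"] fin L1_def by auto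
  also have "\<dots> = card L1"
    by (rule card_image, rule increasing_inj_on[OF inc(4)]) (auto simp: L1_def)
  also have "\<dots> = card (\<phi> ` L1)"
    by (rule card_image[symmetric], rule increasing_inj_on[OF inc(2)]) (auto simp: L1_def)
  also have "\<dots> \<le> card {c<..<\<phi> a}"
  proof (rule card_mono)
    show "\<phi> ` L1 \<subseteq> {c<..<\<phi> a}"
    proof
      fix d assume "d \<in> \<phi> ` L1"
      then obtain b where b: "b \<in> L" "c \<le> \<psi> b" "\<psi> b < \<psi> a" "d = \<phi> b" unfolding L1_def by blast
      then have "\<phi> b < \<phi> a" using ba[OF aU b(1)] left by blast
      moreover have "c < \<phi> b" using ge[of b] noL[OF b(1)] b by auto
      ultimately show "d \<in> {c<..<\<phi> a}" using b by simp
    qed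
  qed simp
  finally have 1: "\<psi> a - c \<le> \<phi> a - Suc c" by simp
  have "{c..<\<phi> a} \<subseteq> \<phi> ` U1"
  proof
    fix d assume d: "d \<in> {c..<\<phi> a}"
    then obtain y where y: "y \<in> U \<union> L" "\<phi> y = d"
      using gapless_column[OF gap(1), of a d] aU c1 by auto
    then obtain x where "x \<in> U" "\<phi> x = d" using upper[of y] d by auto
    then show "d \<in> \<phi> ` U1" using d unfolding U1_def by auto
  qed
  then have "\<phi> a - c \<le> card (\<phi> ` U1)" using card_mono[of "\<phi> ` U1" "{c..<\<phi> a}"] fin U1_def by auto
  also have "\<dots> = card U1"
    by (rule card_image, rule increasing_inj_on[OF inc(1)]) (auto simp: U1_def)
  also have "\<dots> = card (\<psi> ` U1)"
    by (rule card_image[symmetric], rule increasing_inj_on[OF inc(3)]) (auto simp: U1_def)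
  also have "\<dots> \<le> card {c..<\<psi> a}"
  proof (rule card_mono)
    show "\<psi> ` U1 \<subseteq> {c..<\<psi> a}"
      using increasing_column[OF inc(3) _ aU] increasing_less[OF inc(1) _ aU] ge
      unfolding U1_def by auto
  qed simp
  finally have "\<phi> a - c \<le> \<psi> a - c" by simp
  then show False using 1 ca by simp
qed

text \<open>
  Although \<open>block\<close> does not mention the rows, they are determined by the row of \<open>f 0\<close>: incomparable
  elements cannot be in the same row, nor can two elements of the same column.
\<close>
lemma block_rows:
  assumes blk: "block (S \<union> T) \<phi> t f g" and inc: "increasing S \<phi>" "increasing T \<phi>"
    and f0: "f 0 \<in> S"
  shows "k \<le> t \<Longrightarrow> f k \<in> S" and "k < t \<Longrightarrow> g k \<in> T"
proof -
  note fE = block_f[OF blk] and ff = block_less[OF blk] and gE = block_g[OF blk] block_fg(1,2)[OF blk]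
  have gT: "g k \<in> T" if "k < t" "f k \<in> S" for k
  proof -
    have "g k \<noteq> f k" using gE(2)[OF that(1)] fE(2)[of k] that(1) by auto
    then have "g k \<notin> S" using increasing_compare[OF inc(1) _ that(2)] gE(3,4)[OF that(1)] by blast
    then show ?thesis using gE(1)[OF that(1)] by blast
  qed
  have fS: "f k \<in> S" if "k \<le> t" for k using that
  proof (induction k)
    case 0 then show ?case using f0 by simp
  next
    case (Suc k)
    then have k: "k < t" "f k \<in> S" by auto
    have "f (Suc k) \<noteq> g k" using ff[OF k(1)] gE(4)[OF k(1)] by auto
    moreover have "\<phi> (f (Suc k)) = \<phi> (g k)" using fE(2)[OF Suc(2)] gE(2)[OF k(1)] by simp
    ultimately have "f (Suc k) \<notin> T" using increasing_inj[OF inc(2) _ gT[OF k]] by blast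
    then show ?case using fE(1)[OF Suc(2)] by blast
  qed
  then show "k \<le> t \<Longrightarrow> f k \<in> S" and "k < t \<Longrightarrow> g k \<in> T" using gT by auto
qed

lemma block_column:
  assumes blk: "block (S \<union> T) \<phi> t f g" and inc: "increasing S \<phi>" "increasing T \<phi>"
    and f0: "f 0 \<in> S" and dis: "S \<inter> T = {}"
    and x: "\<phi> (f 0) \<le> \<phi> x" "\<phi> x \<le> \<phi> (f 0) + t"
  shows "x \<in> S \<Longrightarrow> \<exists>k\<le>t. x = f k \<and> \<phi> x = \<phi> (f 0) + k"
    and "x \<in> T \<Longrightarrow> \<exists>k<t. x = g k \<and> \<phi> x = \<phi> (f 0) + Suc k"
proof -
  define k where "k = \<phi> x - \<phi> (f 0)"
  have k: "k \<le> t" "\<phi> x = \<phi> (f 0) + k" using x k_def by auto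
  have fk: "f k \<in> S" "\<phi> (f k) = \<phi> x"
    using block_rows(1)[OF blk inc f0 k(1)] block_f(2)[OF blk k(1)] k(2) by simp_all
  show "\<exists>k\<le>t. x = f k \<and> \<phi> x = \<phi> (f 0) + k" if "x \<in> S"
    using increasing_inj[OF inc(1) that fk(1)] fk k by auto
  show "\<exists>k<t. x = g k \<and> \<phi> x = \<phi> (f 0) + Suc k" if "x \<in> T"
  proof -
    have "x \<noteq> f 0" using f0 that dis by blast
    then have "\<phi> x \<noteq> \<phi> (f 0)" using block_start[OF blk, of x] that by blast
    then obtain j where j: "k = Suc j" using k by (cases k) auto
    then have "g j \<in> T" "\<phi> (g j) = \<phi> x"
      using block_rows(2)[OF blk inc f0, of j] block_g(2)[OF blk, of j] k by simp_all
    then have "x = g j" using increasing_inj[OF inc(2) that] by metis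
    then show ?thesis using j k by auto
  qed
qed

lemma block_mono:
  assumes blk: "block E \<phi> t f g" and "i \<le> j" "j \<le> t"
  shows "f i = f j \<or> f i \<prec> f j"
  using assms(2,3)
proof (induction j rule: dec_induct)
  case (step n)
  then have "f n \<prec> f (Suc n)" using block_less[OF blk] by simp
  moreover have "f i = f n \<or> f i \<prec> f n" using step by simp
  ultimately show ?case using trans[of "f i" "f n"] by auto
qed simp

text \<open>
  Elements of different rows of a block are incomparable or ordered as their columns are. This is what
  makes the asymmetric condition in \<open>arranged\<close> survive the exchange of the two rows.
\<close>
lemma block_incomparable:
  assumes blk: "block (S \<union> T) \<phi> t f g" and inc: "increasing S \<phi>" "increasing T \<phi>"
    and f0: "f 0 \<in> S" and dis: "S \<inter> T = {}"
    and x: "x \<in> S" "\<phi> (f 0) \<le> \<phi> x" "\<phi> x \<le> \<phi> (f 0) + t"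
    and y: "y \<in> T" "\<phi> (f 0) \<le> \<phi> y" "\<phi> y \<le> \<phi> (f 0) + t"
  shows "\<phi> y \<le> \<phi> x \<Longrightarrow> \<not> x \<prec> y" and "\<phi> x \<le> \<phi> y \<Longrightarrow> \<not> y \<prec> x"
proof -
  obtain i where i: "i \<le> t" "x = f i" "\<phi> x = \<phi> (f 0) + i"
    using block_column(1)[OF blk inc f0 dis x(2,3,1)] by blast
  obtain j where j: "j < t" "y = g j" "\<phi> y = \<phi> (f 0) + Suc j"
    using block_column(2)[OF blk inc f0 dis y(2,3,1)] by blast
  have g: "\<not> g j \<prec> f (Suc j)" "\<not> f (Suc j) \<prec> g j" using block_fg(3,4)[OF blk j(1)] .
  show "\<not> x \<prec> y" if "\<phi> y \<le> \<phi> x"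
  proof -
    have "f (Suc j) = x \<or> f (Suc j) \<prec> x" using block_mono[OF blk, of "Suc j" i] i j that by simp
    then show ?thesis using g(2) j(2) trans by blast
  qed
  show "\<not> y \<prec> x" if "\<phi> x \<le> \<phi> y"
  proof -
    have "x = f (Suc j) \<or> x \<prec> f (Suc j)" using block_mono[OF blk, of i "Suc j"] i j that by simp
    then show ?thesis using g(1) j(2) trans by blast
  qed
qed

text \<open>
  Suppose that \<open>\<psi>\<close> has an upper element in the column of \<open>s\<close>. Then \<open>\<psi>\<close> pairs, column by column, the
  members \<open>f 0, f 1, \<dots>\<close> of the block of \<open>s\<close> with \<open>g 0, g 1, \<dots>\<close>, that is, shifted by one column against
  \<open>\<phi>\<close>. It cannot interrupt this by a solo element, because that would put \<open>g k\<close> below \<open>f (k + 1)\<close>. So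
  finally \<open>f t\<close> shares its column with an upper element that is to the right of the block under \<open>\<phi>\<close>,
  hence above \<open>f t\<close>, contrary to the asymmetric condition for \<open>\<psi>\<close>.
\<close>
lemma no_upper_at_lower_solo:
  assumes al: "aligned U L \<phi>" "aligned U L \<psi>" and ag: "agree_below (U \<union> L) c \<phi> \<psi>"
    and s: "solo L U \<phi> s" "\<phi> s = c" and a0: "a0 \<in> U" "\<psi> a0 = c"
  shows False
proof -
  have arr: "arranged U L \<phi>" "arranged U L \<psi>" using al unfolding aligned_def by simp_all
  have inc: "increasing U \<phi>" "increasing L \<phi>" "increasing U \<psi>" "increasing L \<psi>"
    and gap: "gapless (U \<union> L) \<phi>" "gapless (U \<union> L) \<psi>" and dis: "U \<inter> L = {}"
    and ba: "\<And>a b. a \<in> U \<Longrightarrow> b \<in> L \<Longrightarrow> b \<prec> a \<Longrightarrow> \<psi> b < \<psi> a"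
    using arr unfolding arranged_def by blast+
  have ge: "c \<le> \<phi> x \<longleftrightarrow> c \<le> \<psi> x" if "x \<in> U \<union> L" for x
    using agree_below_ge[OF ag that] .
  have sL: "s \<in> L" using s unfolding solo_def by simp
  have noU: "\<phi> a \<noteq> c" if "a \<in> U" for a using s that unfolding solo_def by auto
  obtain t f g where f0: "f 0 = s" and blk0: "block (U \<union> L) \<phi> t f g"
    using aligned_block[OF al(1)] s(1) by blast
  then have blk: "block (L \<union> U) \<phi> t f g" by (simp add: Un_commute)
  have dis': "L \<inter> U = {}" using dis by blast
  have f0': "f 0 \<in> L" using f0 sL by simp
  have fE: "f k \<in> L" "\<phi> (f k) = c + k" if "k \<le> t" for k
    using block_rows(1)[OF blk inc(2,1) f0' that] block_f(2)[OF blk that] f0 s by simp_all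
  have gE: "g k \<in> U" "\<phi> (g k) = c + Suc k" "\<not> g k \<prec> f (Suc k)" if "k < t" for k
    using block_rows(2)[OF blk inc(2,1) f0' that] block_g(2)[OF blk that] block_fg(3)[OF blk that] f0 s
    by simp_all
  have colU: "\<exists>k<t. x = g k" if "x \<in> U" "c \<le> \<phi> x" "\<phi> x \<le> c + t" for x
    using block_column(2)[OF blk inc(2,1) f0' dis' _ _ that(1)] f0 s that by auto
  have cut: "x \<prec> y" if z: "solo U L \<psi> z \<or> solo L U \<psi> z"
    and xy: "x \<in> U \<union> L" "y \<in> U \<union> L" "\<psi> x < \<psi> z" "\<psi> z \<le> \<psi> y" for x y z
  proof -
    obtain t' f' g' where b: "f' 0 = z" "block (U \<union> L) \<psi> t' f' g'"
      using aligned_block[OF al(2) z] by blast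
    show ?thesis using block_left[OF b(2) xy(1,2)] b(1) xy(3,4) by simp
  qed
  have inv: "\<psi> (f k) = c + k \<and> (\<exists>a\<in>U. \<psi> a = c + k) \<and> (\<forall>j<k. \<psi> (g j) = c + j)" if "k \<le> t" for k
    using that
  proof (induction k)
    case 0
    have "agree_below (U \<union> L) c \<psi> \<phi>" using ag unfolding agree_below_def by metis
    then have "\<not> solo U L \<psi> a0" using no_lower_at_upper_solo[OF al(2,1) _ _ a0(2) sL s(2)] by blast
    then obtain b where b: "b \<in> L" "\<psi> b = c" using a0 unfolding solo_def by auto
    have "c \<le> \<phi> b" "c \<le> \<psi> s" using ge[of b] ge[of s] b sL s by auto
    then have "\<psi> s = c"
      using increasing_less[OF inc(4) b(1) sL] increasing_column[OF inc(2) b(1) sL] b s by fastforce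
    then show ?case using a0 f0 by auto
  next
    case (Suc k)
    then have k: "k < t" by simp
    obtain a where a: "a \<in> U" "\<psi> a = c + k" and fk: "\<psi> (f k) = c + k"
      and gj: "\<And>j. j < k \<Longrightarrow> \<psi> (g j) = c + j"
      using Suc by auto
    have gk: "\<psi> (g k) = c + k"
    proof (rule linorder_cases[of "\<psi> (g k)" "c + k"])
      \<comment> \<open>The columns before \<open>c + k\<close> are taken by the earlier \<open>g j\<close>.\<close>
      assume l: "\<psi> (g k) < c + k"
      define j where "j = \<psi> (g k) - c"
      have "c \<le> \<psi> (g k)" using ge[of "g k"] gE[OF k] by simp
      then have j: "j < k" "\<psi> (g k) = c + j" using l j_def by auto
      then have "g k = g j" using increasing_inj[OF inc(3) gE(1)[OF k] gE(1)[of j]] gj k by simp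
      then show ?thesis using gE(2)[OF k] gE(2)[of j] j k by simp
    next
      assume l: "c + k < \<psi> (g k)"
      have "a \<prec> g k" using increasing_less[OF inc(3) a(1) gE(1)[OF k]] a l by simp
      then have ak: "\<phi> a < c + Suc k"
        using increasing_column[OF inc(1) a(1) gE(1)[OF k]] gE(2)[OF k] by simp
      moreover have "c \<le> \<phi> a" using ge[of a] a by simp
      ultimately obtain j where "j < t" "a = g j" using colU[OF a(1)] k by auto
      then show ?thesis using gE(2)[of j] gj[of j] ak a(2) by simp
    qed
    have lt: "c + k < \<psi> (f (Suc k))"
    proof -
      have "f k \<prec> f (Suc k)" using block_less[OF blk k] .
      then show ?thesis using increasing_column[OF inc(4), of "f k" "f (Suc k)"] fE fk k by simp
    qed
    have fS: "f (Suc k) \<in> L" using fE Suc by simp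
    obtain z where z: "z \<in> U \<union> L" "\<psi> z = c + Suc k"
      using gapless_column[OF gap(2), of "f (Suc k)" "c + Suc k"] fS lt by auto
    have "\<not> (solo U L \<psi> z \<or> solo L U \<psi> z)"
      using cut[of z "g k" "f (Suc k)"] gE[OF k] gk fS lt z by auto
    then obtain a' b where a': "a' \<in> U" "\<psi> a' = c + Suc k" and b: "b \<in> L" "\<psi> b = c + Suc k"
      using z unfolding solo_def by (metis UnE)
    have "f k \<prec> b" using increasing_less[OF inc(4) fE(1) b(1), of k] fk b k by simp
    then have "c + k < \<phi> b" using increasing_column[OF inc(2) fE(1) b(1), of k] fE(2)[of k] k by simp
    then have "\<not> b \<prec> f (Suc k)"
      using increasing_column[OF inc(2) b(1) fS] fE(2)[OF Suc(2)] by auto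
    then have "\<psi> (f (Suc k)) = c + Suc k"
      using increasing_less[OF inc(4) b(1) fS] b(2) lt by fastforce
    then show ?case using a' gk gj less_Suc_eq by auto
  qed
  obtain a where a: "a \<in> U" "\<psi> a = c + t" using inv[of t] by blast
  have "c + t < \<phi> a"
  proof (rule ccontr)
    assume "\<not> c + t < \<phi> a"
    then obtain j where "j < t" "a = g j" using colU[OF a(1)] ge[of a] a by auto
    then show False using inv[of t] a by simp
  qed
  then have "f t \<prec> a" using block_right[OF blk, of "f t" a] fE[of t] f0 s a(1) by simp
  then show False using ba[OF a(1) fE(1)[of t]] inv[of t] a by simp
qed

lemma agree_below_sym: "agree_below E c \<phi> \<psi> \<Longrightarrow> agree_below E c \<psi> \<phi>"
  unfolding agree_below_def by metis

text \<open>
  If a row has an element in column \<open>c\<close> under \<open>\<phi>\<close>, it has one under \<open>\<psi>\<close> as well, since otherwise the other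
  row would have a solo element there under \<open>\<psi>\<close>, in a column in which \<open>\<phi>\<close> has an element of the
  first row. Both are the smallest element of the row that is not in an earlier column.
\<close>
lemma agree_column:
  assumes al: "aligned U L \<phi>" "aligned U L \<psi>" and ag: "agree_below (U \<union> L) c \<phi> \<psi>"
    and y: "y \<in> U \<union> L" "\<phi> y = c"
  shows "\<psi> y = c"
proof -
  have inc: "increasing U \<phi>" "increasing L \<phi>" "increasing U \<psi>" "increasing L \<psi>"
    and gap: "gapless (U \<union> L) \<phi>" "gapless (U \<union> L) \<psi>"
    using al unfolding aligned_def arranged_def by simp_all
  note sym = agree_below_sym[OF ag]
  have cy: "c \<le> \<psi> y" using agree_below_ge[OF ag y(1)] y(2) by simp
  have c1: "1 \<le> c" using bspec[OF gap(1)[unfolded gapless_def] y(1)] y(2) by simp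
  obtain z where z: "z \<in> U \<union> L" "\<psi> z = c"
    using gapless_column[OF gap(2) y(1) c1 cy] by blast
  have eq: "\<psi> y = c"
    if inc_S: "increasing S \<phi>" "increasing S \<psi>" and S: "S \<subseteq> U \<union> L" "y \<in> S" "w \<in> S" "\<psi> w = c"
    for S w
  proof (rule ccontr)
    assume n: "\<psi> y \<noteq> c"
    have "w \<prec> y" using increasing_less[OF inc_S(2) S(3,2)] S(4) n cy by simp
    then have "\<phi> w < c" using increasing_column[OF inc_S(1) S(3,2)] y(2) by simp
    moreover have "w \<in> U \<union> L" using S by blast
    ultimately show False using agree_below_ge[OF ag, of w] S(4) by simp
  qed
  show ?thesis
  proof (cases "y \<in> U")
    case True
    have "\<not> solo L U \<psi> z"
      using no_upper_at_lower_solo[OF al(2,1) sym _ z(2) True y(2)] by blast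
    then obtain w where "w \<in> U" "\<psi> w = c" using z unfolding solo_def by auto
    then show ?thesis using eq[OF inc(1,3) _ True] by simp
  next
    case False
    then have yL: "y \<in> L" using y(1) by blast
    have "\<not> solo U L \<psi> z"
      using no_lower_at_upper_solo[OF al(2,1) sym _ z(2) yL y(2)] by blast
    then obtain w where "w \<in> L" "\<psi> w = c" using z unfolding solo_def by auto
    then show ?thesis using eq[OF inc(2,4) _ yL] by simp
  qed
qed

theorem aligned_unique:
  assumes al: "aligned U L \<phi>" "aligned U L \<psi>" and x: "x \<in> U \<union> L"
  shows "\<phi> x = \<psi> x"
proof -
  have "agree_below (U \<union> L) c \<phi> \<psi>" for c
  proof (induction c)
    case 0 then show ?case unfolding agree_below_def by simp
  next
    case (Suc c)
    note columns = agree_column[OF al Suc.IH] agree_column[OF al(2,1) agree_below_sym[OF Suc.IH]]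
    show ?case
      unfolding agree_below_def
    proof (intro ballI impI)
      fix y assume y: "y \<in> U \<union> L" "\<phi> y < Suc c \<or> \<psi> y < Suc c"
      show "\<phi> y = \<psi> y"
      proof (cases "\<phi> y < c \<or> \<psi> y < c")
        case True
        then show ?thesis using Suc.IH y(1) unfolding agree_below_def by blast
      next
        case False
        then have "\<phi> y = c \<or> \<psi> y = c" using y(2) by auto
        then show ?thesis using columns[OF y(1)] by metis
      qed
    qed
  qed
  from this[of "Suc (\<phi> x)"] show ?thesis
    using x lessI unfolding agree_below_def by blast
qed

section \<open>Exchanging the rows in a block\<close>
lemma solo_cong:
  "(\<And>x. x \<in> S \<union> T \<Longrightarrow> \<phi> x = \<psi> x) \<Longrightarrow> solo S T \<phi> x \<longleftrightarrow> solo S T \<psi> x"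
  unfolding solo_def by auto

lemma block_cong:
  assumes "\<And>x. x \<in> E \<Longrightarrow> \<phi> x = \<psi> x" "block E \<phi> t f g"
  shows "block E \<psi> t f g"
proof -
  note blk = assms(2)
  have f0: "f 0 \<in> E" using block_f(1)[OF blk, of 0] by simp
  have e: "\<psi> x = \<phi> x" if "x \<in> E" for x using assms(1)[OF that] by simp
  show ?thesis
    unfolding block_def
  proof (intro conjI ballI allI impI)
    fix x assume "x \<in> E" "\<psi> x = \<psi> (f 0)"
    then show "x = f 0" using block_start[OF blk, of x] e f0 by simp
  next
    fix k assume "k \<le> t"
    then show "f k \<in> E" "\<psi> (f k) = \<psi> (f 0) + k" using block_f[OF blk, of k] e f0 by simp_all
  next
    fix k assume k: "k < t"
    then show "f k \<prec> f (Suc k)" using block_less[OF blk] by simp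
    show "g k \<in> E" "\<psi> (g k) = \<psi> (f 0) + Suc k" using block_g[OF blk k] e f0 by simp_all
    show "\<not> g k \<prec> f k" "\<not> f k \<prec> g k" "\<not> g k \<prec> f (Suc k)" "\<not> f (Suc k) \<prec> g k"
      using block_fg[OF blk k] .
  next
    fix x y assume xy: "x \<in> E" "y \<in> E"
    show "x \<prec> y" if "\<psi> x < \<psi> (f 0)" "\<psi> (f 0) \<le> \<psi> y"
      using block_left[OF blk xy] that e xy f0 by simp
    show "x \<prec> y" if "\<psi> x \<le> \<psi> (f 0) + t" "\<psi> (f 0) + t < \<psi> y"
      using block_right[OF blk xy] that e xy f0 by simp
  qed
qed

definition swapped :: "'a set \<Rightarrow> 'a set \<Rightarrow> ('a \<Rightarrow> nat) \<Rightarrow> nat \<Rightarrow> nat \<Rightarrow> 'a set" where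
  "swapped S T \<phi> c d = {x\<in>S. \<phi> x \<notin> {c..d}} \<union> {x\<in>T. \<phi> x \<in> {c..d}}"

lemma swapped_swapped: "swapped (swapped S T \<phi> c d) (swapped T S \<phi> c d) \<phi> c d = S"
  unfolding swapped_def by auto

lemma swapped_Un: "swapped S T \<phi> c d \<union> swapped T S \<phi> c d = S \<union> T"
  unfolding swapped_def by auto

lemma solo_swapped:
  "solo (swapped S T \<phi> c d) (swapped T S \<phi> c d) \<phi> x \<longleftrightarrow>
     (if \<phi> x \<in> {c..d} then solo T S \<phi> x else solo S T \<phi> x)"
  unfolding solo_def swapped_def by auto

lemma increasing_swapped:
  assumes inc: "increasing S \<phi>" "increasing T \<phi>"
    and left: "\<And>x y. x \<in> S \<union> T \<Longrightarrow> y \<in> S \<union> T \<Longrightarrow> \<phi> x < c \<Longrightarrow> c \<le> \<phi> y \<Longrightarrow> x \<prec> y"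
    and right: "\<And>x y. x \<in> S \<union> T \<Longrightarrow> y \<in> S \<union> T \<Longrightarrow> \<phi> x \<le> d \<Longrightarrow> d < \<phi> y \<Longrightarrow> x \<prec> y"
  shows "increasing (swapped S T \<phi> c d) \<phi>"
proof (unfold increasing_def, intro ballI impI)
  fix x y assume xy: "x \<in> swapped S T \<phi> c d" "y \<in> swapped S T \<phi> c d" "x \<noteq> y"
  have mixed: "u \<prec> v \<and> \<phi> u < \<phi> v \<or> v \<prec> u \<and> \<phi> v < \<phi> u"
    if "u \<in> S" "\<phi> u \<notin> {c..d}" "v \<in> T" "\<phi> v \<in> {c..d}" for u v
    using that left[of u v] right[of v u] by auto
  show "x \<prec> y \<and> \<phi> x < \<phi> y \<or> y \<prec> x \<and> \<phi> y < \<phi> x"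
    using xy mixed[of x y] mixed[of y x] inc unfolding swapped_def increasing_def by blast
qed

lemma swapped_cong:
  "(\<And>x. x \<in> S \<union> T \<Longrightarrow> \<phi> x = \<psi> x) \<Longrightarrow> swapped S T \<phi> c d = swapped S T \<psi> c d"
  unfolding swapped_def by auto

lemma solo_in_block:
  assumes blk: "block (U \<union> L) \<phi> t f g" and inc: "increasing U \<phi>" "increasing L \<phi>"
    and x: "solo U L \<phi> x \<or> solo L U \<phi> x" "\<phi> x \<in> {\<phi> (f 0)..\<phi> (f 0) + t}"
  shows "x = f 0"
proof (rule ccontr)
  assume n: "x \<noteq> f 0"
  have xE: "x \<in> U \<union> L" using x unfolding solo_def by blast
  then have "\<phi> x \<noteq> \<phi> (f 0)" using block_start[OF blk xE] n by blast
  define k where "k = \<phi> x - Suc (\<phi> (f 0))"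
  have k: "k < t" "\<phi> x = \<phi> (f 0) + Suc k" using x(2) \<open>\<phi> x \<noteq> \<phi> (f 0)\<close> k_def by auto
  have fg: "f (Suc k) \<in> U \<union> L" "\<phi> (f (Suc k)) = \<phi> x" "g k \<in> U \<union> L" "\<phi> (g k) = \<phi> x"
    "f k \<prec> f (Suc k)" "\<not> f k \<prec> g k"
    using block_f[OF blk, of "Suc k"] block_g[OF blk k(1)] block_less[OF blk k(1)]
      block_fg(2)[OF blk k(1)] k by simp_all
  have "y = x" if "y \<in> U \<union> L" "\<phi> y = \<phi> x" for y
    using x(1) solo_unique[OF inc(1), of L x y] solo_unique[OF inc(2), of U x y] that by blast
  then have "f (Suc k) = x" "g k = x" using fg by blast+
  then show False using fg by simp
qed

text \<open>
  Blocks and gaplessness do not refer to the individual rows. The choice of the solo element keeps solo lower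
  elements to the left of solo upper ones: \<open>f 0\<close>, the only solo element in its block, is the one that changes
  rows. For a lower \<open>y\<close> below an upper \<open>x\<close>, the new rows can only violate the asymmetric condition if
  both lie inside the block, where \<open>block_incomparable\<close> excludes it.
\<close>
lemma aligned_swapped:
  assumes al: "aligned U L \<phi>" and blk: "block (U \<union> L) \<phi> t f g"
    and c: "c = \<phi> (f 0)" and d: "d = c + t"
    and s: "solo U L \<phi> (f 0) \<and> (\<forall>a. solo U L \<phi> a \<longrightarrow> c \<le> \<phi> a) \<or>
            solo L U \<phi> (f 0) \<and> (\<forall>b. solo L U \<phi> b \<longrightarrow> \<phi> b \<le> c)"
  shows "aligned (swapped U L \<phi> c d) (swapped L U \<phi> c d) \<phi>"
proof -
  let ?U = "swapped U L \<phi> c d" and ?L = "swapped L U \<phi> c d"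
  have sub: "U \<union> L \<subseteq> P" and dis: "U \<inter> L = {}" and inc: "increasing U \<phi>" "increasing L \<phi>"
    and gap: "gapless (U \<union> L) \<phi>"
    and BA: "\<And>a b. solo U L \<phi> a \<Longrightarrow> solo L U \<phi> b \<Longrightarrow> \<phi> b < \<phi> a"
    and ba: "\<And>a b. a \<in> U \<Longrightarrow> b \<in> L \<Longrightarrow> b \<prec> a \<Longrightarrow> \<phi> b < \<phi> a"
    using al unfolding aligned_def arranged_def by blast+
  have left: "x \<prec> y" if "x \<in> U \<union> L" "y \<in> U \<union> L" "\<phi> x < c" "c \<le> \<phi> y" for x y
    using block_left[OF blk that(1,2)] that c by simp
  have right: "x \<prec> y" if "x \<in> U \<union> L" "y \<in> U \<union> L" "\<phi> x \<le> d" "d < \<phi> y" for x y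
    using block_right[OF blk that(1,2)] that c d by simp
  have blk': "block (L \<union> U) \<phi> t f g" using blk by (simp add: Un_commute)
  have dis': "L \<inter> U = {}" using dis by blast
  have incomp: "\<not> x \<prec> y"
    if "x \<in> U" "y \<in> L" "\<phi> x \<in> {c..d}" "\<phi> y \<in> {c..d}" "\<phi> y \<le> \<phi> x" for x y
  proof (cases "f 0 \<in> U")
    case True
    show ?thesis using block_incomparable(1)[OF blk inc True dis, of x y] that c d by simp
  next
    case False
    then have "f 0 \<in> L" using block_f(1)[OF blk, of 0] by simp
    from block_incomparable(2)[OF blk' inc(2,1) this dis', of y x] show ?thesis using that c d by simp
  qed
  have only: "x = f 0" if "solo U L \<phi> x \<or> solo L U \<phi> x" "\<phi> x \<in> {c..d}" for x
    using solo_in_block[OF blk inc that(1)] that(2) c d by simp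
  have "increasing ?U \<phi>" using increasing_swapped[OF inc left right] by blast
  moreover have "increasing ?L \<phi>" using increasing_swapped[OF inc(2,1)] left right by blast
  moreover have "?U \<union> ?L \<subseteq> P" "gapless (?U \<union> ?L) \<phi>" using sub gap by (simp_all add: swapped_Un)
  moreover have "?U \<inter> ?L = {}" using dis unfolding swapped_def by auto
  moreover have "\<phi> y < \<phi> x" if x: "solo ?U ?L \<phi> x" and y: "solo ?L ?U \<phi> y" for x y
  proof -
    have c_in: "c \<in> {c..d}" using d by simp
    have x': "solo U L \<phi> x \<and> \<phi> x \<noteq> c \<or> solo L U \<phi> x \<and> x = f 0"
      using x only[of x] c_in unfolding solo_swapped by (cases "\<phi> x \<in> {c..d}") auto
    have y': "solo L U \<phi> y \<and> \<phi> y \<noteq> c \<or> solo U L \<phi> y \<and> y = f 0"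
      using y only[of y] c_in unfolding solo_swapped by (cases "\<phi> y \<in> {c..d}") auto
    have nb: "\<not> (solo U L \<phi> (f 0) \<and> solo L U \<phi> (f 0))" using dis unfolding solo_def by blast
    show ?thesis using s
    proof
      assume s: "solo U L \<phi> (f 0) \<and> (\<forall>a. solo U L \<phi> a \<longrightarrow> c \<le> \<phi> a)"
      have "c < \<phi> x" using x' s nb by (metis le_neq_implies_less)
      moreover have "\<phi> y \<le> c" using y' BA[of "f 0" y] s c by fastforce
      ultimately show ?thesis by simp
    next
      assume s: "solo L U \<phi> (f 0) \<and> (\<forall>b. solo L U \<phi> b \<longrightarrow> \<phi> b \<le> c)"
      have "\<phi> y < c" using y' s nb by (metis le_neq_implies_less)
      moreover have "c \<le> \<phi> x" using x' BA[of x "f 0"] s c by fastforce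
      ultimately show ?thesis by simp
    qed
  qed
  moreover have "\<phi> y < \<phi> x" if x: "x \<in> ?U" and y: "y \<in> ?L" and yx: "y \<prec> x" for x y
  proof (rule ccontr)
    assume n: "\<not> \<phi> y < \<phi> x"
    have E: "x \<in> U \<union> L" "y \<in> U \<union> L" using x y unfolding swapped_def by auto
    have "\<not> x \<prec> y" using yx asym by blast
    then consider "\<phi> x \<in> {c..d}" "\<phi> y \<in> {c..d}" | "\<phi> x \<notin> {c..d}" "\<phi> y \<notin> {c..d}"
      using n left[OF E] right[OF E] by fastforce
    then show False
    proof cases
      case 1
      then show False using incomp[of y x] n x y yx unfolding swapped_def by auto
    next
      case 2
      then show False using ba[of x y] n x y yx unfolding swapped_def by auto
    qed
  qed
  ultimately have "arranged ?U ?L \<phi>" unfolding arranged_def by blast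
  moreover have "\<exists>t f g. f 0 = x \<and> block (?U \<union> ?L) \<phi> t f g"
    if "solo ?U ?L \<phi> x \<or> solo ?L ?U \<phi> x" for x
  proof -
    have "solo U L \<phi> x \<or> solo L U \<phi> x" using that unfolding solo_swapped by (auto split: if_splits)
    then obtain t f g where "f 0 = x" "block (U \<union> L) \<phi> t f g" using aligned_block[OF al] by blast
    then show ?thesis unfolding swapped_Un by blast
  qed
  ultimately show ?thesis unfolding aligned_def by blast
qed

end

section \<open>Arrays and their alignments\<close>

locale free_poset =
  fixes P :: "'a set" and R :: "'a rel"
  assumes finite_carrier: "finite P" and partial_order: "partial_order_on P R"
    and three_one_free: "three_plus_one_free P R"
begin

abbreviation less :: "'a \<Rightarrow> 'a \<Rightarrow> bool" (infix "\<prec>" 50) where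
  "x \<prec> y \<equiv> strictly_below R x y"

lemma order_refl: "x \<in> P \<Longrightarrow> (x, x) \<in> R"
  using partial_order unfolding partial_order_on_def preorder_on_def refl_on_def by blast

lemma order_iff: "x \<in> P \<Longrightarrow> (x, y) \<in> R \<longleftrightarrow> x = y \<or> x \<prec> y"
  using order_refl unfolding strictly_below_def by blast

sublocale free_order P "strictly_below R"
proof
  have tr: "trans R" and an: "antisym R"
    using partial_order unfolding partial_order_on_def preorder_on_def by blast+
  show "finite P" by (rule finite_carrier)
  show "\<not> x \<prec> x" for x by (simp add: strictly_below_def)
  show "x \<prec> z" if "x \<prec> y" "y \<prec> z" for x y z
  proof -
    have "(x, z) \<in> R" using that tr unfolding strictly_below_def by (meson transD)
    moreover have "x \<noteq> z" using that an unfolding strictly_below_def by (meson antisymD)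
    ultimately show ?thesis unfolding strictly_below_def by simp
  qed
  show "w \<prec> x \<or> x \<prec> w \<or> w \<prec> y \<or> y \<prec> w \<or> w \<prec> z \<or> z \<prec> w"
    if P: "x \<in> P" "y \<in> P" "z \<in> P" "w \<in> P" and xyz: "x \<prec> y" "y \<prec> z" for x y z w
  proof (rule ccontr)
    assume n: "\<not> ?thesis"
    then have "w \<noteq> x" "w \<noteq> y" "w \<noteq> z" using xyz by auto
    then have "incomparable R w x" "incomparable R w y" "incomparable R w z"
      using n unfolding incomparable_def strictly_below_def by auto
    then show False using three_one_free P xyz unfolding three_plus_one_free_def by blast
  qed
qed

lemma array_pos: "A \<in> P_arrays P R \<Longrightarrow> A (i, j) = Some x \<Longrightarrow> 1 \<le> j"
  unfolding P_arrays_def by (force simp: dom_def)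

lemma array_in: "A \<in> P_arrays P R \<Longrightarrow> A (i, j) = Some x \<Longrightarrow> x \<in> P"
  unfolding P_arrays_def by (auto simp: ran_def)

lemma array_inj:
  assumes "A \<in> P_arrays P R" "A (i, j) = Some x" "A (i', j') = Some x"
  shows "i = i' \<and> j = j'"
proof -
  have "inj_on A (dom A)" using assms(1) unfolding P_arrays_def by blast
  then have "(i, j) = (i', j')" using assms(2,3) by (metis domI inj_onD)
  then show ?thesis by simp
qed

lemma array_previous:
  assumes A: "A \<in> P_arrays P R" and "A (i, k) = Some x" "1 \<le> j" "j < k"
  shows "\<exists>y. A (i, j) = Some y \<and> y \<prec> x"
  using assms(2,4)
proof (induction k arbitrary: x)
  case (Suc k)
  have "\<forall>i j x. A (i, j) = Some x \<longrightarrow> 1 < j \<longrightarrow> (\<exists>y. A (i, j - 1) = Some y \<and> y \<prec> x)"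
    using A unfolding P_arrays_def by simp
  moreover have "1 < Suc k" using Suc(3) assms(3) by simp
  ultimately obtain y where y: "A (i, k) = Some y" "y \<prec> x"
    using Suc(2) diff_Suc_1 by metis
  show ?case
  proof (cases "j = k")
    case True then show ?thesis using y by blast
  next
    case False
    then obtain z where "A (i, j) = Some z" "z \<prec> y" using Suc(1)[OF y(1)] Suc(3) by auto
    then show ?thesis using y(2) trans by blast
  qed
qed simp

lemma array_less:
  assumes "A \<in> P_arrays P R" "A (i, j) = Some x" "A (i, k) = Some y" "j < k"
  shows "x \<prec> y"
  using array_previous[OF assms(1,3) array_pos[OF assms(1,2)] assms(4)] assms(2) by auto

lemma index_in_row_eq: "A \<in> P_arrays P R \<Longrightarrow> A (i, j) = Some x \<Longrightarrow> index_in_row A i x = j"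
  unfolding index_in_row_def using array_inj by blast

lemma array_index: "A \<in> P_arrays P R \<Longrightarrow> x \<in> row_elems A i \<Longrightarrow> A (i, index_in_row A i x) = Some x"
  unfolding row_elems_def using index_in_row_eq by fastforce

lemma row_elemsI: "A \<in> P_arrays P R \<Longrightarrow> A (i, j) = Some x \<Longrightarrow> x \<in> row_elems A i"
  unfolding row_elems_def by blast

lemma row_elems_subset: "A \<in> P_arrays P R \<Longrightarrow> row_elems A i \<subseteq> P"
  unfolding row_elems_def using array_in by blast

lemma row_elems_disjoint: "A \<in> P_arrays P R \<Longrightarrow> i \<noteq> i' \<Longrightarrow> row_elems A i \<inter> row_elems A i' = {}"
  unfolding row_elems_def using array_inj by blast

lemma increasing_index:
  assumes A: "A \<in> P_arrays P R"
  shows "increasing (row_elems A i) (index_in_row A i)"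
proof (unfold increasing_def, intro ballI impI)
  fix x y assume xy: "x \<in> row_elems A i" "y \<in> row_elems A i" "x \<noteq> y"
  note ix = array_index[OF A xy(1)] array_index[OF A xy(2)]
  have "index_in_row A i x \<noteq> index_in_row A i y" using ix xy(3) by auto
  then show "x \<prec> y \<and> index_in_row A i x < index_in_row A i y \<or>
      y \<prec> x \<and> index_in_row A i y < index_in_row A i x"
    using array_less[OF A ix] array_less[OF A ix(2,1)] by linarith
qed

text \<open>
  In a finite chain, the number of elements below or equal to \<open>x\<close> determines \<open>x\<close>. The function \<open>\<phi>\<close> only serves to
  express that \<open>S i\<close> is a chain.
\<close>
lemma array_of_rows_iff:
  assumes sub: "S i \<subseteq> P" and inc: "increasing (S i) \<phi>"
  shows "array_of_rows R S (i, j) = Some x \<longleftrightarrow> x \<in> S i \<and> card {y \<in> S i. (y, x) \<in> R} = j"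
proof -
  have fin: "finite (S i)" using finite_subset[OF sub finite_P] .
  have lt: "card {z \<in> S i. (z, x) \<in> R} < card {z \<in> S i. (z, y) \<in> R}"
    if "x \<in> S i" "y \<in> S i" "x \<prec> y" for x y
  proof (rule psubset_card_mono)
    have P: "z \<in> P" if "z \<in> S i" for z using that sub by blast
    have "(z, y) \<in> R" if "z \<in> S i" "(z, x) \<in> R" for z
    proof -
      have "z = x \<or> z \<prec> x" using order_iff[OF P] that by simp
      then have "z \<prec> y" using \<open>x \<prec> y\<close> trans by blast
      then show ?thesis unfolding strictly_below_def by simp
    qed
    then have "{z \<in> S i. (z, x) \<in> R} \<subseteq> {z \<in> S i. (z, y) \<in> R}" by blast
    moreover have "y \<in> {z \<in> S i. (z, y) \<in> R}" using that order_refl[OF P] by simp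
    moreover have "y \<notin> {z \<in> S i. (z, x) \<in> R}"
      using order_iff[OF P, of y x] that asym[of x y] irrefl[of x] by auto
    ultimately show "{z \<in> S i. (z, x) \<in> R} \<subset> {z \<in> S i. (z, y) \<in> R}" by blast
  qed (use fin in simp)
  have uniq: "y = x" if "x \<in> S i" "y \<in> S i"
    "card {z \<in> S i. (z, y) \<in> R} = card {z \<in> S i. (z, x) \<in> R}" for x y
    using increasing_compare[OF inc that(1,2)] lt[OF that(1,2)] lt[OF that(2,1)] that(3) by auto
  define Q where "Q j x \<longleftrightarrow> x \<in> S i \<and> card {y \<in> S i. (y, x) \<in> R} = j" for j x
  have "(THE x. Q j x) = x" if "Q j x" for x
    using that uniq unfolding Q_def by (intro the_equality) auto
  then have "(if \<exists>x. Q j x then Some (THE x. Q j x) else None) = Some x \<longleftrightarrow> Q j x"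
    by (smt (verit) option.distinct(1) option.inject)
  then show ?thesis unfolding array_of_rows_def Q_def by (simp add: Bex_def)
qed

lemma row_elems_array_of_rows:
  assumes "S i \<subseteq> P" "increasing (S i) \<phi>"
  shows "row_elems (array_of_rows R S) i = S i"
  unfolding row_elems_def array_of_rows_iff[where S = S and i = i, OF assms] by blast

lemma array_of_rows_row_elems:
  assumes A: "A \<in> P_arrays P R"
  shows "array_of_rows R (row_elems A) = A"
proof (rule ext)
  fix p :: "nat \<times> nat"
  obtain i j where p: "p = (i, j)" by (cases p)
  have card: "card {y \<in> row_elems A i. (y, x) \<in> R} = k" if x: "A (i, k) = Some x" for k x
  proof -
    have "bij_betw (\<lambda>y. index_in_row A i y) {y \<in> row_elems A i. (y, x) \<in> R} {1..k}"
    proof (rule bij_betwI')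
      fix y z assume "y \<in> {y \<in> row_elems A i. (y, x) \<in> R}" "z \<in> {y \<in> row_elems A i. (y, x) \<in> R}"
      then show "index_in_row A i y = index_in_row A i z \<longleftrightarrow> y = z"
        using increasing_inj[OF increasing_index[OF A]] by blast
    next
      fix y assume "y \<in> {y \<in> row_elems A i. (y, x) \<in> R}"
      then have y: "y \<in> row_elems A i" "(y, x) \<in> R" by auto
      have "y = x \<or> y \<prec> x" using y order_iff row_elems_subset[OF A] by blast
      then have "\<not> k < index_in_row A i y"
        using array_less[OF A x array_index[OF A y(1)]] asym irrefl by blast
      then show "index_in_row A i y \<in> {1..k}"
        using array_pos[OF A array_index[OF A y(1)]] by simp
    next
      fix l assume l: "l \<in> {1..k}"
      have "\<exists>y. A (i, l) = Some y \<and> (y = x \<or> y \<prec> x)"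
        using array_previous[OF A x, of l] x l by (cases "l = k") auto
      then obtain y where y: "A (i, l) = Some y" "y = x \<or> y \<prec> x" by blast
      then have "(y, x) \<in> R" using order_iff array_in[OF A y(1)] by blast
      then show "\<exists>y\<in>{y \<in> row_elems A i. (y, x) \<in> R}. l = index_in_row A i y"
        using row_elemsI[OF A y(1)] index_in_row_eq[OF A y(1)] by blast
    qed
    from bij_betw_same_card[OF this] show ?thesis by simp
  qed
  have iff: "array_of_rows R (row_elems A) (i, j) = Some x \<longleftrightarrow> A (i, j) = Some x" for x
    unfolding array_of_rows_iff[where S = "row_elems A" and i = i,
        OF row_elems_subset[OF A] increasing_index[OF A]]
  proof (intro iffI conjI; (elim conjE)?)
    assume x: "x \<in> row_elems A i" and "card {y \<in> row_elems A i. (y, x) \<in> R} = j"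
    then have "index_in_row A i x = j" using card[OF array_index[OF A x]] by simp
    then show "A (i, j) = Some x" using array_index[OF A x] by simp
  next
    assume x: "A (i, j) = Some x"
    show "x \<in> row_elems A i" by (rule row_elemsI[OF A x])
    show "card {y \<in> row_elems A i. (y, x) \<in> R} = j" by (rule card[OF x])
  qed
  show "array_of_rows R (row_elems A) p = A p"
    unfolding p using iff[of "the (A (i, j))"] iff[of "the (array_of_rows R (row_elems A) (i, j))"]
    by (cases "A (i, j)"; cases "array_of_rows R (row_elems A) (i, j)") simp_all
qed

lemma finite_below:
  assumes A: "A \<in> P_arrays P R"
  shows "finite {i. \<exists>a b. A (r, k) = Some a \<and> A (r', i) = Some b \<and> Q b a}"
proof -
  have "{i. \<exists>a b. A (r, k) = Some a \<and> A (r', i) = Some b \<and> Q b a} \<subseteq> index_in_row A r' ` P"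
  proof
    fix i assume "i \<in> {i. \<exists>a b. A (r, k) = Some a \<and> A (r', i) = Some b \<and> Q b a}"
    then obtain b where b: "A (r', i) = Some b" by blast
    then show "i \<in> index_in_row A r' ` P"
      using array_in[OF A b] index_in_row_eq[OF A b] by auto
  qed
  then show ?thesis using finite_P finite_surj by blast
qed

lemma pre_col_cases:
  assumes A: "A \<in> P_arrays P R" and a: "A (r, k) = Some a"
  shows pre_col_below: "A (r + 1, i) = Some b \<Longrightarrow> b \<prec> a \<Longrightarrow> i < pre_col R A r k"
    and pre_col_less: "1 \<le> j \<Longrightarrow> j < k \<Longrightarrow> pre_col R A r j < pre_col R A r k"
    and pre_col_max: "pre_col R A r k = 1 \<or>
      (\<exists>i b. A (r + 1, i) = Some b \<and> b \<prec> a \<and> pre_col R A r k = i + 1) \<or>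
      (\<exists>j. 1 \<le> j \<and> j < k \<and> pre_col R A r k = pre_col R A r j + 1)"
proof -
  define M where "M = insert 0
     ({i. \<exists>a b. A (r, k) = Some a \<and> A (r + 1, i) = Some b \<and> b \<prec> a} \<union>
      (\<lambda>i. pre_col R A r i) ` {1..<k})"
  have eq: "pre_col R A r k = Max M + 1" unfolding M_def by (subst pre_col.simps) simp
  have fin: "finite M" unfolding M_def using finite_below[OF A] by simp
  show "i < pre_col R A r k" if "A (r + 1, i) = Some b" "b \<prec> a"
  proof -
    have "i \<in> M" unfolding M_def using that a by blast
    then show ?thesis using Max_ge[OF fin] eq by fastforce
  qed
  show "pre_col R A r j < pre_col R A r k" if "1 \<le> j" "j < k"
  proof -
    have "pre_col R A r j \<in> M" unfolding M_def using that by simp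
    then show ?thesis using Max_ge[OF fin] eq by fastforce
  qed
  have "Max M \<in> M" using Max_in[OF fin] unfolding M_def by blast
  then have "Max M = 0 \<or> (\<exists>b. A (r + 1, Max M) = Some b \<and> b \<prec> a) \<or>
      (\<exists>j. 1 \<le> j \<and> j < k \<and> Max M = pre_col R A r j)"
    using a unfolding M_def[symmetric] by (subst (asm) (2) M_def) auto
  then show "pre_col R A r k = 1 \<or>
      (\<exists>i b. A (r + 1, i) = Some b \<and> b \<prec> a \<and> pre_col R A r k = i + 1) \<or>
      (\<exists>j. 1 \<le> j \<and> j < k \<and> pre_col R A r k = pre_col R A r j + 1)"
    using eq by auto
qed

text \<open>
  The columns of the lower row are its indices, so that they have no gaps, and solo upper elements are to the
  right of the whole lower row. By the recursion for \<open>pre_col\<close>, an upper element to the right of a solo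
  \<open>b\<close> is above \<open>b\<close>. Hence no path leaves a solo lower element.
\<close>
lemma prealigned_pre_alignment:
  assumes A: "A \<in> P_arrays P R"
  shows "prealigned (row_elems A r) (row_elems A (r + 1)) (pre_alignment R A r)"
proof -
  let ?U = "row_elems A r" and ?L = "row_elems A (r + 1)" and ?\<phi> = "pre_alignment R A r"
  have dis: "?U \<inter> ?L = {}" using row_elems_disjoint[OF A] by simp
  have U: "?\<phi> a = pre_col R A r k" if "A (r, k) = Some a" for k a
    unfolding pre_alignment_def using row_elemsI[OF A that] index_in_row_eq[OF A that] by simp
  have L: "?\<phi> b = k" if "A (r + 1, k) = Some b" for k b
  proof -
    have "b \<notin> ?U" using row_elemsI[OF A that] dis by blast
    then show ?thesis unfolding pre_alignment_def using index_in_row_eq[OF A that] by simp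
  qed
  have Uk: "\<exists>k. A (r, k) = Some a" if "a \<in> ?U" for a using that unfolding row_elems_def by blast
  have Lk: "A (r + 1, ?\<phi> b) = Some b" if "b \<in> ?L" for b 
    unfolding L[OF array_index[OF A that]] by (rule array_index[OF A that])
  have incU: "increasing ?U ?\<phi>"
  proof (unfold increasing_def, intro ballI impI)
    fix x y assume xy: "x \<in> ?U" "y \<in> ?U" "x \<noteq> y"
    obtain j k where jk: "A (r, j) = Some x" "A (r, k) = Some y" using Uk[OF xy(1)] Uk[OF xy(2)] by blast
    have pos: "1 \<le> j" "1 \<le> k" using array_pos[OF A] jk by blast+
    show "x \<prec> y \<and> ?\<phi> x < ?\<phi> y \<or> y \<prec> x \<and> ?\<phi> y < ?\<phi> x"
    proof (rule linorder_cases[of j k])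
      assume "j < k"
      then have "x \<prec> y" "?\<phi> x < ?\<phi> y"
        unfolding U[OF jk(1)] U[OF jk(2)]
        using array_less[OF A jk] pre_col_less[OF A jk(2) pos(1)] by blast+
      then show ?thesis by blast
    next
      assume "j = k"
      then show ?thesis using jk xy(3) by simp
    next
      assume "k < j"
      then have "y \<prec> x" "?\<phi> y < ?\<phi> x"
        unfolding U[OF jk(1)] U[OF jk(2)]
        using array_less[OF A jk(2,1)] pre_col_less[OF A jk(1) pos(2)] by blast+
      then show ?thesis by blast
    qed
  qed
  have incL: "increasing ?L ?\<phi>"
  proof (unfold increasing_def, intro ballI impI)
    fix x y assume xy: "x \<in> ?L" "y \<in> ?L" "x \<noteq> y"
    have "?\<phi> x \<noteq> ?\<phi> y" using Lk[OF xy(1)] Lk[OF xy(2)] xy(3) by auto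
    then show "x \<prec> y \<and> ?\<phi> x < ?\<phi> y \<or> y \<prec> x \<and> ?\<phi> y < ?\<phi> x"
      using array_less[OF A Lk[OF xy(1)] Lk[OF xy(2)]] array_less[OF A Lk[OF xy(2)] Lk[OF xy(1)]]
      by linarith
  qed
  have ba: "?\<phi> b < ?\<phi> a" if a: "a \<in> ?U" and b: "b \<in> ?L" "b \<prec> a" for a b
  proof -
    obtain k where k: "A (r, k) = Some a" using Uk[OF a] by blast
    show ?thesis using pre_col_below[OF A k Lk[OF b(1)] b(2)] U[OF k] by simp
  qed
  have gap: "gapless (?U \<union> ?L) ?\<phi>"
  proof (unfold gapless_def, intro ballI)
    fix x assume "x \<in> ?U \<union> ?L"
    then show "1 \<le> ?\<phi> x \<and> (1 < ?\<phi> x \<longrightarrow> (\<exists>y\<in>?U \<union> ?L. ?\<phi> y + 1 = ?\<phi> x))"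
    proof
      assume "x \<in> ?L"
      note x = Lk[OF this]
      have "\<exists>y\<in>?L. ?\<phi> y + 1 = ?\<phi> x" if g: "1 < ?\<phi> x"
      proof -
        have "1 \<le> ?\<phi> x - 1" "?\<phi> x - 1 < ?\<phi> x" using g by simp_all
        from array_previous[OF A x this] obtain y where y: "A (r + 1, ?\<phi> x - 1) = Some y" by blast
        have "?\<phi> y + 1 = ?\<phi> x" unfolding L[OF y] using g by simp
        then show ?thesis using row_elemsI[OF A y] by blast
      qed
      then show ?thesis using array_pos[OF A x] by blast
    next
      assume "x \<in> ?U"
      then obtain k where k: "A (r, k) = Some x" using Uk[of x] by blast
      show ?thesis using pre_col_max[OF A k]
      proof (elim disjE exE conjE)
        assume "pre_col R A r k = 1" then show ?thesis using U[OF k] by simp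
      next
        fix i b assume b: "A (r + 1, i) = Some b" "pre_col R A r k = i + 1"
        then have "?\<phi> b + 1 = ?\<phi> x" 
          unfolding L[OF b(1)] U[OF k] by simp
        then show ?thesis using row_elemsI[OF A b(1)] by (metis UnI2 le_add2)
      next
        fix j assume j: "1 \<le> j" "j < k" "pre_col R A r k = pre_col R A r j + 1"
        obtain y where y: "A (r, j) = Some y" using array_previous[OF A k j(1,2)] by blast
        then have "?\<phi> y + 1 = ?\<phi> x" 
          using j(3) unfolding U[OF y] U[OF k] by simp
        then show ?thesis using row_elemsI[OF A y] by (metis UnI1 le_add2)
      qed
    qed
  qed
  have BA: "?\<phi> b < ?\<phi> a" if a: "solo ?U ?L ?\<phi> a" and b: "solo ?L ?U ?\<phi> b" for a b
  proof (rule ccontr)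
    assume n: "\<not> ?thesis"
    have bL: "b \<in> ?L" and aU: "a \<in> ?U" using a b unfolding solo_def by auto
    have "1 \<le> ?\<phi> a" using bspec[OF gap[unfolded gapless_def], of a] aU by simp
    moreover have "?\<phi> a \<noteq> ?\<phi> b" using b aU unfolding solo_def by auto
    ultimately obtain y where y: "A (r + 1, ?\<phi> a) = Some y"
      using array_previous[OF A Lk[OF bL], of "?\<phi> a"] n by auto
    then show False using a L[OF y] row_elemsI[OF A y] unfolding solo_def by auto
  qed
  have after: "b \<prec> a" if b: "solo ?L ?U ?\<phi> b" and a: "a \<in> ?U" "?\<phi> b < ?\<phi> a" for a b
  proof -
    have bL: "b \<in> ?L" using b unfolding solo_def by simp
    have b1: "1 \<le> ?\<phi> b" using array_pos[OF A Lk[OF bL]] .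
    have "b \<prec> a" if "A (r, k) = Some a" "?\<phi> b < ?\<phi> a" for k a
      using that
    proof (induction k arbitrary: a rule: less_induct)
      case (less k)
      note k = less(2)
      show ?case using pre_col_max[OF A k]
      proof (elim disjE exE conjE)
        assume "pre_col R A r k = 1" then show ?thesis using U[OF k] less(3) b1 by simp
      next
        fix i y assume y: "A (r + 1, i) = Some y" "y \<prec> a" "pre_col R A r k = i + 1"
        have yL: "y \<in> ?L" using row_elemsI[OF A y(1)] .
        have "?\<phi> b \<le> ?\<phi> y" using y L[OF y(1)] U[OF k] less(3) by simp
        then have "b = y \<or> b \<prec> y"
          using increasing_less[OF incL bL yL] increasing_inj[OF incL bL yL] by linarith
        then show ?thesis using y(2) trans by blast
      next
        fix j assume j: "1 \<le> j" "j < k" "pre_col R A r k = pre_col R A r j + 1"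
        obtain y where y: "A (r, j) = Some y" "y \<prec> a" using array_previous[OF A k j(1,2)] by blast
        have "?\<phi> y \<noteq> ?\<phi> b" using b row_elemsI[OF A y(1)] unfolding solo_def by auto
        then have "?\<phi> b < ?\<phi> y" using j U[OF y(1)] U[OF k] less(3) by simp
        then show ?thesis using less(1)[OF j(2) y(1)] y(2) trans by blast
      qed
    qed
    then show ?thesis using Uk[OF a(1)] a(2) by blast
  qed
  have linked: "solo ?L ?U ?\<phi> b" if "linked ?L ?U ?\<phi> b" for b
    using that
  proof (induction rule: linked.induct)
    case (step x y x')
    then show ?case using after[of x y] by simp
  qed
  have cut: "b \<prec> a" if "solo ?L ?U ?\<phi> s" "b \<in> ?L" "a \<in> ?U" "?\<phi> b < ?\<phi> s" "?\<phi> s < ?\<phi> a" for s b a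
  proof -
    have "b \<prec> s" using increasing_less[OF incL that(2) _ that(4)] that(1) unfolding solo_def by blast
    then show ?thesis using after[OF that(1,3,5)] trans by blast
  qed
  have link: "\<exists>b'\<in>?L. ?\<phi> b' = ?\<phi> a \<and> \<not> a \<prec> b'"
    if "linked ?L ?U ?\<phi> b" "a \<in> ?U" "?\<phi> a = ?\<phi> b + 1" "\<not> b \<prec> a" for a b
    using after[OF linked[OF that(1)] that(2)] that(3,4) by simp
  have "arranged ?U ?L ?\<phi>"
    unfolding arranged_def using row_elems_subset[OF A] dis incU incL gap BA ba by blast
  then show ?thesis unfolding prealigned_def using cut link by blast
qed

lemma movable_iff_mobile:
  "movable R A r \<phi> x \<longleftrightarrow> mobile (row_elems A r \<union> row_elems A (r + 1)) \<phi> x"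
  unfolding movable_def mobile_def column_def by blast

lemma alignment_seq_step:
  assumes "\<exists>x. movable R A r (alignment_seq R A r k) x"
    and bound: "\<And>x. x \<in> row_elems A r \<union> row_elems A (r + 1) \<Longrightarrow> alignment_seq R A r k x \<le> N"
  obtains x where "mobile (row_elems A r \<union> row_elems A (r + 1)) (alignment_seq R A r k) x"
    and "alignment_seq R A r (Suc k) = (alignment_seq R A r k)(x := alignment_seq R A r k x + 1)"
proof -
  let ?\<phi> = "alignment_seq R A r k"
  define x where "x = (ARG_MAX ?\<phi> x. movable R A r ?\<phi> x)"
  obtain z where z: "movable R A r ?\<phi> z" using assms(1) by blast
  have b: "\<forall>y. movable R A r ?\<phi> y \<longrightarrow> ?\<phi> y < N + 1"
    using bound unfolding movable_def by fastforce
  have "movable R A r ?\<phi> x"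
    unfolding x_def using arg_max_natI[of "movable R A r ?\<phi>", OF z b] .
  moreover have "alignment_seq R A r (Suc k) = ?\<phi>(x := ?\<phi> x + 1)"
    unfolding alignment_seq.simps Let_def x_def using assms(1) by (simp only: if_True)
  ultimately show thesis using that movable_iff_mobile by blast
qed

lemma alignment_seq_invariant:
  assumes A: "A \<in> P_arrays P R"
    and bound: "\<And>x. x \<in> row_elems A r \<union> row_elems A (r + 1) \<Longrightarrow> pre_alignment R A r x \<le> N"
  shows "prealigned (row_elems A r) (row_elems A (r + 1)) (alignment_seq R A r k) \<and>
    (\<forall>x \<in> row_elems A r \<union> row_elems A (r + 1). alignment_seq R A r k x \<le> N)"
proof (induction k)
  case 0
  then show ?case using prealigned_pre_alignment[OF A] bound by simp
next
  case (Suc k)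
  let ?E = "row_elems A r \<union> row_elems A (r + 1)" and ?\<phi> = "alignment_seq R A r k"
  show ?case
  proof (cases "\<exists>x. movable R A r ?\<phi> x")
    case True
    have "\<And>x. x \<in> ?E \<Longrightarrow> ?\<phi> x \<le> N" using Suc by blast
    from alignment_seq_step[OF True this] obtain x where x: "mobile ?E ?\<phi> x"
      "alignment_seq R A r (Suc k) = ?\<phi>(x := ?\<phi> x + 1)" by blast
    obtain y where "y \<in> ?E" "?\<phi> y = ?\<phi> x + 1" using x(1) unfolding mobile_def by blast
    then have "?\<phi> x + 1 \<le> N" using Suc by metis
    moreover have "prealigned (row_elems A r) (row_elems A (r + 1)) (?\<phi>(x := ?\<phi> x + 1))"
      using prealigned_move Suc x(1) by blast
    ultimately show ?thesis unfolding x(2) using Suc by (simp del: fun_upd_apply) simp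
  next
    case False
    then have "alignment_seq R A r (Suc k) = ?\<phi>" 
      by (simp only: alignment_seq.simps Let_def False if_False)
    then show ?thesis using Suc by simp
  qed
qed

text \<open>
  Elements only move into nonempty columns, so all columns stay bounded, whereas the sum of the
  columns grows with each move.
\<close>
lemma alignment_seq_stops:
  assumes A: "A \<in> P_arrays P R"
  shows "\<exists>k. \<not> (\<exists>x. movable R A r (alignment_seq R A r k) x)"
proof (rule ccontr)
  assume never: "\<nexists>k. \<not> (\<exists>x. movable R A r (alignment_seq R A r k) x)"
  define E where "E = row_elems A r \<union> row_elems A (r + 1)"
  have fin: "finite E"
    unfolding E_def using finite_subset[OF row_elems_subset[OF A] finite_P] by simp
  define N where "N = Max (insert 0 (pre_alignment R A r ` E))"
  have "pre_alignment R A r x \<le> N" if "x \<in> E" for x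
    unfolding N_def using that fin by (intro Max_ge) auto
  then have inv: "alignment_seq R A r k x \<le> N" if "x \<in> E" for k x
    using alignment_seq_invariant[OF A, of r N k] that unfolding E_def by blast
  have "k \<le> sum (alignment_seq R A r k) E" for k
  proof (induction k)
    case (Suc k)
    let ?\<phi> = "alignment_seq R A r k"
    have "\<exists>x. movable R A r ?\<phi> x" using never by blast
    from alignment_seq_step[OF this inv[unfolded E_def]]
    obtain x where x: "mobile E ?\<phi> x" "alignment_seq R A r (Suc k) = ?\<phi>(x := ?\<phi> x + 1)"
      unfolding E_def by blast
    have xE: "x \<in> E" using x(1) unfolding mobile_def by simp
    have "sum (?\<phi>(x := ?\<phi> x + 1)) E = ?\<phi> x + 1 + sum (?\<phi>(x := ?\<phi> x + 1)) (E - {x})"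
      using sum.remove[OF fin xE, of "?\<phi>(x := ?\<phi> x + 1)"] by simp
    also have "sum (?\<phi>(x := ?\<phi> x + 1)) (E - {x}) = sum ?\<phi> (E - {x})"
      by (rule sum.cong) auto
    also have "?\<phi> x + 1 + sum ?\<phi> (E - {x}) = sum ?\<phi> E + 1"
      using sum.remove[OF fin xE, of ?\<phi>] by simp
    finally show ?case using Suc x(2) by simp
  qed simp
  moreover have "sum (alignment_seq R A r k) E \<le> N * card E" for k
    using sum_bounded_above[of E "alignment_seq R A r k" N] inv by (simp add: mult.commute)
  ultimately have "Suc (N * card E) \<le> N * card E" using order_trans by blast
  then show False by simp
qed

theorem aligned_alignment:
  assumes A: "A \<in> P_arrays P R"
  shows "aligned (row_elems A r) (row_elems A (r + 1)) (alignment R A r)"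
proof (rule prealigned_imp_aligned)
  let ?E = "row_elems A r \<union> row_elems A (r + 1)"
  have fin: "finite ?E" using finite_subset[OF row_elems_subset[OF A] finite_P] by simp
  have "pre_alignment R A r x \<le> Max (pre_alignment R A r ` ?E)" if "x \<in> ?E" for x
    using that fin by (intro Max_ge) auto
  from alignment_seq_invariant[OF A this]
  show "prealigned (row_elems A r) (row_elems A (r + 1)) (alignment R A r)"
    unfolding alignment_def by blast
  show "\<not> mobile ?E (alignment R A r) x" for x
    using LeastI_ex[OF alignment_seq_stops[OF A, of r]]
    unfolding alignment_def movable_iff_mobile by blast
qed

section \<open>The operators\<close>

text \<open>
  The elements \<open>f 0, \<dots>, f t\<close> occupy consecutive columns, so nothing in their row lies between two of
  them.
\<close>
lemma run_in_array:
  assumes A: "A \<in> P_arrays P R" and inc: "increasing (row_elems A i) \<phi>" "increasing T \<phi>"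
    and blk: "block (row_elems A i \<union> T) \<phi> t f g" and p: "A (i, p) = Some (f 0)"
    and "k \<le> t"
  shows "A (i, p + k) = Some (f k)"
  using assms(6)
proof (induction k)
  case 0 then show ?case using p by simp
next
  case (Suc k)
  then have k: "k < t" and fk: "A (i, p + k) = Some (f k)" by auto
  have fS: "f k \<in> row_elems A i" "f (Suc k) \<in> row_elems A i"
    using block_rows(1)[OF blk inc row_elemsI[OF A p]] Suc(2) by simp_all
  define q where "q = index_in_row A i (f (Suc k))"
  have q: "A (i, q) = Some (f (Suc k))" unfolding q_def by (rule array_index[OF A fS(2)])
  have "f k \<prec> f (Suc k)" by (rule block_less[OF blk k])
  then have "\<not> q < p + k" "q \<noteq> p + k" using array_less[OF A q fk] asym irrefl q fk by auto
  moreover have "\<not> p + k + 1 < q"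
  proof
    assume "p + k + 1 < q"
    then obtain y where y: "A (i, p + k + 1) = Some y" "y \<prec> f (Suc k)"
      using array_previous[OF A q, of "p + k + 1"] by auto
    have yS: "y \<in> row_elems A i" by (rule row_elemsI[OF A y(1)])
    have "\<phi> (f k) < \<phi> y" using increasing_column[OF inc(1) fS(1) yS] array_less[OF A fk y(1)] by simp
    moreover have "\<phi> y < \<phi> (f (Suc k))" by (rule increasing_column[OF inc(1) yS fS(2) y(2)])
    ultimately show False using block_f(2)[OF blk, of k] block_f(2)[OF blk Suc(2)] k by simp
  qed
  ultimately have "q = p + Suc k" by simp
  then show ?case using q by simp
qed

text \<open>
  The run of an operator is the block that starts at its first element: \<open>g k\<close> is the element that lets
  the run go on after \<open>f k\<close>, and all elements to the right of the block are above \<open>f t\<close>.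
\<close>
lemma move_run_eq:
  assumes A: "A \<in> P_arrays P R" and "i \<noteq> i'"
    and inc: "increasing (row_elems A i) \<phi>" "increasing (row_elems A i') \<phi>"
    and blk: "block (row_elems A i \<union> row_elems A i') \<phi> t f g" and p: "A (i, p) = Some (f 0)"
    and c: "c = \<phi> (f 0)" and d: "d = c + t"
  shows "move_run R A i i' \<phi> p = array_of_rows R ((row_elems A)
    (i := swapped (row_elems A i) (row_elems A i') \<phi> c d,
     i' := swapped (row_elems A i') (row_elems A i) \<phi> c d))"
proof -
  let ?S = "row_elems A i" and ?T = "row_elems A i'"
  have dis: "?S \<inter> ?T = {}" by (rule row_elems_disjoint[OF A assms(2)])
  have f0: "f 0 \<in> ?S" by (rule row_elemsI[OF A p])
  note run = run_in_array[OF A inc blk p]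
  have len: "run_length R A i i' \<phi> p = t"
    unfolding run_length_def
  proof (rule Least_equality)
    have "f t \<prec> y" if "y \<in> ?T" "\<phi> y = \<phi> (f t) + 1" for y
      using block_right[OF blk block_f(1)[OF blk order.refl], of y] block_f(2)[OF blk order.refl] that
      by simp
    then show "\<exists>x. A (i, p + t) = Some x \<and> \<not> (\<exists>y\<in>?T. \<phi> y = \<phi> x + 1 \<and> \<not> x \<prec> y)"
      using run[of t] by blast
  next
    fix k assume ex: "\<exists>x. A (i, p + k) = Some x \<and> \<not> (\<exists>y\<in>?T. \<phi> y = \<phi> x + 1 \<and> \<not> x \<prec> y)"
    show "t \<le> k"
    proof (rule ccontr)
      assume "\<not> t \<le> k"
      then have k: "k < t" by simp
      have "g k \<in> ?T" "\<phi> (g k) = \<phi> (f k) + 1" "\<not> f k \<prec> g k"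
        using block_rows(2)[OF blk inc f0 k] block_g(2)[OF blk k] block_f(2)[OF blk, of k]
          block_fg(2)[OF blk k] k by simp_all
      then show False using ex run[of k] k by auto
    qed
  qed
  have X: "{x. \<exists>k\<in>{p..p + t}. A (i, k) = Some x} = {x \<in> ?S. \<phi> x \<in> {c..d}}" (is "?X = _")
  proof (intro equalityI subsetI)
    fix x assume "x \<in> ?X"
    then obtain q where "q \<in> {p..p + t}" "A (i, q) = Some x" by blast
    then have k: "q - p \<le> t" "A (i, p + (q - p)) = Some x" by auto
    then have x: "x = f (q - p)" using run[OF k(1)] by simp
    then show "x \<in> {x \<in> ?S. \<phi> x \<in> {c..d}}"
      using row_elemsI[OF A k(2)] block_f(2)[OF blk k(1)] k(1) c d by simp
  next
    fix x assume "x \<in> {x \<in> ?S. \<phi> x \<in> {c..d}}"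
    then obtain k where k: "k \<le> t" "x = f k"
      using block_column(1)[OF blk inc f0 dis, of x] c d by auto
    then have "p + k \<in> {p..p + t}" "A (i, p + k) = Some x" using run[of k] by simp_all
    then show "x \<in> ?X" by blast
  qed
  have Y: "{y \<in> ?T. \<exists>x \<in> {x \<in> ?S. \<phi> x \<in> {c..d}}. \<phi> y = \<phi> x} = {y \<in> ?T. \<phi> y \<in> {c..d}}" (is "?Y = _")
  proof (intro equalityI subsetI)
    fix y assume y: "y \<in> {y \<in> ?T. \<phi> y \<in> {c..d}}"
    define k where "k = \<phi> y - c"
    have k: "k \<le> t" "\<phi> y = c + k" using y d k_def by auto
    have "f k \<in> ?S" "\<phi> y = \<phi> (f k)"
      using block_rows(1)[OF blk inc f0 k(1)] block_f(2)[OF blk k(1)] c k by simp_all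
    then show "y \<in> ?Y" using y by auto
  qed auto
  have "?S - {x \<in> ?S. \<phi> x \<in> {c..d}} \<union> {y \<in> ?T. \<phi> y \<in> {c..d}} = swapped ?S ?T \<phi> c d"
    "?T - {y \<in> ?T. \<phi> y \<in> {c..d}} \<union> {x \<in> ?S. \<phi> x \<in> {c..d}} = swapped ?T ?S \<phi> c d"
    unfolding swapped_def by auto
  then show ?thesis
    unfolding move_run_def Let_def exchange_def len X Y by simp
qed

text \<open>
  The common form of the results of both operators, which shows that each of them is undone by the
  exchange of the same columns.
\<close>
definition toggle :: "'a parray \<Rightarrow> nat \<Rightarrow> ('a \<Rightarrow> nat) \<Rightarrow> nat \<Rightarrow> nat \<Rightarrow> 'a parray" where
  "toggle A r \<phi> c d = array_of_rows R ((row_elems A)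
     (r := swapped (row_elems A r) (row_elems A (r + 1)) \<phi> c d,
      r + 1 := swapped (row_elems A (r + 1)) (row_elems A r) \<phi> c d))"

lemma row_elems_toggle:
  assumes A: "A \<in> P_arrays P R"
    and al: "aligned (swapped (row_elems A r) (row_elems A (r + 1)) \<phi> c d)
      (swapped (row_elems A (r + 1)) (row_elems A r) \<phi> c d) \<phi>"
  shows "row_elems (toggle A r \<phi> c d) = (row_elems A)
     (r := swapped (row_elems A r) (row_elems A (r + 1)) \<phi> c d,
      r + 1 := swapped (row_elems A (r + 1)) (row_elems A r) \<phi> c d)"
proof
  let ?S = "(row_elems A)
     (r := swapped (row_elems A r) (row_elems A (r + 1)) \<phi> c d,
      r + 1 := swapped (row_elems A (r + 1)) (row_elems A r) \<phi> c d)"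
  fix i
  have "?S i \<subseteq> P"
    using row_elems_subset[OF A] unfolding swapped_def by auto
  moreover have "increasing (?S i) (if i = r \<or> i = r + 1 then \<phi> else index_in_row A i)"
    using al increasing_index[OF A] unfolding aligned_def arranged_def by auto
  ultimately show "row_elems (toggle A r \<phi> c d) i = ?S i"
    unfolding toggle_def by (rule row_elems_array_of_rows)
qed

lemma toggle_toggle:
  assumes A: "A \<in> P_arrays P R"
    and rows: "row_elems B = (row_elems A)
     (r := swapped (row_elems A r) (row_elems A (r + 1)) \<phi> c d,
      r + 1 := swapped (row_elems A (r + 1)) (row_elems A r) \<phi> c d)"
  shows "toggle B r \<phi> c d = A"
proof -
  have "toggle B r \<phi> c d = array_of_rows R (row_elems A)"
    unfolding toggle_def rows by (rule arg_cong[of _ _ "array_of_rows R"]) (auto simp: swapped_swapped)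
  then show ?thesis using array_of_rows_row_elems[OF A] by simp
qed

lemma unpaired_iff: "A \<in> P_arrays P R \<Longrightarrow>
    unpaired A i i' \<phi> p \<longleftrightarrow> (\<exists>x. A (i, p) = Some x \<and> solo (row_elems A i) (row_elems A i') \<phi> x)"
  unfolding unpaired_def solo_def using row_elemsI by auto

lemma toggle_cong:
  assumes "\<And>x. x \<in> row_elems A r \<union> row_elems A (r + 1) \<Longrightarrow> \<phi> x = \<psi> x"
  shows "toggle A r \<phi> c d = toggle A r \<psi> c d"
proof -
  have "swapped (row_elems A r) (row_elems A (r + 1)) \<phi> c d = swapped (row_elems A r) (row_elems A (r + 1)) \<psi> c d"
    "swapped (row_elems A (r + 1)) (row_elems A r) \<phi> c d = swapped (row_elems A (r + 1)) (row_elems A r) \<psi> c d"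
    using assms by (intro swapped_cong; blast)+
  then show ?thesis unfolding toggle_def by simp
qed

text \<open>
  By uniqueness, any aligned column function can take the place of the alignment. This makes it possible
  to evaluate one operator on the result of the other with the columns of the original array.
\<close>
lemma lowering_eq:
  assumes A: "A \<in> P_arrays P R"
    and al: "aligned (row_elems A r) (row_elems A (r + 1)) \<phi>"
    and s: "solo (row_elems A r) (row_elems A (r + 1)) \<phi> (f 0)"
    and least: "\<And>x. solo (row_elems A r) (row_elems A (r + 1)) \<phi> x \<Longrightarrow> \<phi> (f 0) \<le> \<phi> x"
    and blk: "block (row_elems A r \<union> row_elems A (r + 1)) \<phi> t f g"
  shows "lowering R r A = Some (toggle A r \<phi> (\<phi> (f 0)) (\<phi> (f 0) + t))"
proof -
  let ?U = "row_elems A r" and ?L = "row_elems A (r + 1)"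
  define \<psi> where "\<psi> = alignment R A r"
  have al': "aligned ?U ?L \<psi>" unfolding \<psi>_def by (rule aligned_alignment[OF A])
  have eq: "\<phi> x = \<psi> x" if "x \<in> ?U \<union> ?L" for x using aligned_unique[OF al al' that] .
  have inc: "increasing ?U \<psi>" "increasing ?L \<psi>" using al' unfolding aligned_def arranged_def by blast+
  have solo: "solo ?U ?L \<phi> x \<longleftrightarrow> solo ?U ?L \<psi> x" for x by (rule solo_cong[OF eq])
  have blk': "block (?U \<union> ?L) \<psi> t f g" by (rule block_cong[OF eq blk])
  have sU: "f 0 \<in> ?U" using s unfolding solo_def by simp
  define p where "p = index_in_row A r (f 0)"
  have p: "A (r, p) = Some (f 0)" unfolding p_def by (rule array_index[OF A sU])
  have "(LEAST p. unpaired A r (r + 1) \<psi> p) = p"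
    unfolding unpaired_iff[OF A]
  proof (rule Least_equality)
    show "\<exists>x. A (r, p) = Some x \<and> solo ?U ?L \<psi> x" using p s solo by blast
  next
    fix q assume "\<exists>x. A (r, q) = Some x \<and> solo ?U ?L \<psi> x"
    then obtain x where x: "A (r, q) = Some x" "solo ?U ?L \<psi> x" by blast
    have xU: "x \<in> ?U" by (rule row_elemsI[OF A x(1)])
    have "\<psi> (f 0) \<le> \<psi> x" using least[of x] solo x(2) eq sU xU by simp
    then have "\<not> x \<prec> f 0" using increasing_column[OF inc(1) xU sU] by auto
    then show "p \<le> q" using array_less[OF A x(1) p] by (meson not_less)
  qed
  moreover have "\<not> (\<forall>x\<in>?U. \<exists>y\<in>?L. \<psi> y = \<psi> x)" using s solo unfolding solo_def by blast
  moreover have "move_run R A r (r + 1) \<psi> p = toggle A r \<psi> (\<psi> (f 0)) (\<psi> (f 0) + t)"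
    unfolding toggle_def by (rule move_run_eq[OF A _ inc blk' p]) simp_all
  ultimately have "lowering R r A = Some (toggle A r \<psi> (\<psi> (f 0)) (\<psi> (f 0) + t))"
    unfolding lowering_def Let_def \<psi>_def[symmetric] by simp
  then show ?thesis using toggle_cong[of A r \<phi> \<psi>] eq sU by simp
qed

lemma raising_eq:
  assumes A: "A \<in> P_arrays P R"
    and al: "aligned (row_elems A r) (row_elems A (r + 1)) \<phi>"
    and s: "solo (row_elems A (r + 1)) (row_elems A r) \<phi> (f 0)"
    and greatest: "\<And>x. solo (row_elems A (r + 1)) (row_elems A r) \<phi> x \<Longrightarrow> \<phi> x \<le> \<phi> (f 0)"
    and blk: "block (row_elems A r \<union> row_elems A (r + 1)) \<phi> t f g"
  shows "raising R r A = Some (toggle A r \<phi> (\<phi> (f 0)) (\<phi> (f 0) + t))"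
proof -
  let ?U = "row_elems A r" and ?L = "row_elems A (r + 1)"
  define \<psi> where "\<psi> = alignment R A r"
  have al': "aligned ?U ?L \<psi>" unfolding \<psi>_def by (rule aligned_alignment[OF A])
  have eq: "\<phi> x = \<psi> x" if "x \<in> ?U \<union> ?L" for x using aligned_unique[OF al al' that] .
  have inc: "increasing ?U \<psi>" "increasing ?L \<psi>" using al' unfolding aligned_def arranged_def by blast+
  have solo: "solo ?L ?U \<phi> x \<longleftrightarrow> solo ?L ?U \<psi> x" for x using solo_cong[of ?L ?U \<phi> \<psi>] eq by blast
  have "block (?U \<union> ?L) \<psi> t f g" by (rule block_cong[OF eq blk])
  then have blk': "block (?L \<union> ?U) \<psi> t f g" by (simp only: Un_commute)
  have sL: "f 0 \<in> ?L" using s unfolding solo_def by simp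
  define p where "p = index_in_row A (r + 1) (f 0)"
  have p: "A (r + 1, p) = Some (f 0)" unfolding p_def by (rule array_index[OF A sL])
  have "(GREATEST p. unpaired A (r + 1) r \<psi> p) = p"
    unfolding unpaired_iff[OF A]
  proof (rule Greatest_equality)
    show "\<exists>x. A (r + 1, p) = Some x \<and> solo ?L ?U \<psi> x" using p s solo by blast
  next
    fix q assume "\<exists>x. A (r + 1, q) = Some x \<and> solo ?L ?U \<psi> x"
    then obtain x where x: "A (r + 1, q) = Some x" "solo ?L ?U \<psi> x" by blast
    have xL: "x \<in> ?L" by (rule row_elemsI[OF A x(1)])
    have "\<psi> x \<le> \<psi> (f 0)" using greatest[of x] solo x(2) eq sL xL by simp
    then have "\<not> f 0 \<prec> x" using increasing_column[OF inc(2) sL xL] by auto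
    then show "q \<le> p" using array_less[OF A p x(1)] by (meson not_less)
  qed
  moreover have "\<not> (\<forall>y\<in>?L. \<exists>x\<in>?U. \<psi> x = \<psi> y)" using s solo unfolding solo_def by blast
  moreover have "move_run R A (r + 1) r \<psi> p = toggle A r \<psi> (\<psi> (f 0)) (\<psi> (f 0) + t)"
    unfolding toggle_def
    by (subst move_run_eq[OF A _ inc(2,1) blk' p refl refl]) (simp_all add: fun_upd_twist)
  ultimately have "raising R r A = Some (toggle A r \<psi> (\<psi> (f 0)) (\<psi> (f 0) + t))"
    unfolding raising_def Let_def \<psi>_def[symmetric] by simp
  then show ?thesis using toggle_cong[of A r \<phi> \<psi>] eq sL by simp
qed

text \<open>
  After the exchange, the solo lower elements are the old ones, which are to the left of \<open>f 0\<close>, and \<open>f 0\<close>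
  itself. So raising starts at \<open>f 0\<close>, with the same block.
\<close>
lemma lowering_imp_raising:
  assumes A: "A \<in> P_arrays P R" and A': "A' \<in> P_arrays P R" and low: "lowering R r A = Some A'"
  shows "raising R r A' = Some A"
proof -
  let ?U = "row_elems A r" and ?L = "row_elems A (r + 1)"
  define \<phi> where "\<phi> = alignment R A r"
  have al: "aligned ?U ?L \<phi>" unfolding \<phi>_def by (rule aligned_alignment[OF A])
  have inc: "increasing ?U \<phi>" "increasing ?L \<phi>"
    and BA: "\<And>a b. solo ?U ?L \<phi> a \<Longrightarrow> solo ?L ?U \<phi> b \<Longrightarrow> \<phi> b < \<phi> a"
    using al unfolding aligned_def arranged_def by blast+
  have "\<not> (\<forall>x\<in>?U. \<exists>y\<in>?L. \<phi> y = \<phi> x)"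
    using low unfolding lowering_def Let_def \<phi>_def[symmetric] by (auto split: if_splits)
  then obtain x where "solo ?U ?L \<phi> x" unfolding solo_def by blast
  then obtain s where s: "solo ?U ?L \<phi> s" and least: "\<And>x. solo ?U ?L \<phi> x \<Longrightarrow> \<phi> s \<le> \<phi> x"
    using ex_has_least_nat[of "solo ?U ?L \<phi>" x \<phi>] by blast
  obtain t f g where f0: "f 0 = s" and blk: "block (?U \<union> ?L) \<phi> t f g"
    using aligned_block[OF al] s by blast
  define c where "c = \<phi> (f 0)"
  define d where "d = c + t"
  have A'_eq: "A' = toggle A r \<phi> c d"
    using lowering_eq[where f = f, OF A al _ _ blk] s least low unfolding f0 c_def d_def by simp
  have al': "aligned (swapped ?U ?L \<phi> c d) (swapped ?L ?U \<phi> c d) \<phi>"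
    using aligned_swapped[OF al blk c_def d_def] s least unfolding f0 c_def by blast
  note rows = row_elems_toggle[OF A al', folded A'_eq]
  have r: "row_elems A' r = swapped ?U ?L \<phi> c d" "row_elems A' (r + 1) = swapped ?L ?U \<phi> c d"
    unfolding rows by simp_all
  have "raising R r A' = Some (toggle A' r \<phi> (\<phi> (f 0)) (\<phi> (f 0) + t))"
  proof (rule raising_eq[OF A'])
    show "aligned (row_elems A' r) (row_elems A' (r + 1)) \<phi>" unfolding r by (rule al')
    show "block (row_elems A' r \<union> row_elems A' (r + 1)) \<phi> t f g" unfolding r swapped_Un by (rule blk)
    show "solo (row_elems A' (r + 1)) (row_elems A' r) \<phi> (f 0)"
      unfolding r solo_swapped using s f0 c_def d_def by simp
    fix x assume "solo (row_elems A' (r + 1)) (row_elems A' r) \<phi> x"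
    then have x: "if \<phi> x \<in> {c..d} then solo ?U ?L \<phi> x else solo ?L ?U \<phi> x"
      unfolding r solo_swapped .
    show "\<phi> x \<le> \<phi> (f 0)"
    proof (cases "\<phi> x \<in> {c..d}")
      case True
      then have "solo ?U ?L \<phi> x \<or> solo ?L ?U \<phi> x" using x by (simp only: if_True simp_thms)
      then have "x = f 0" by (rule solo_in_block[OF blk inc]) (use True c_def d_def in simp)
      then show ?thesis by simp
    next
      case False
      then have "solo ?L ?U \<phi> x" using x by (simp only: if_False)
      from less_imp_le[OF BA[OF s this]] show ?thesis unfolding f0 .
    qed
  qed
  then show ?thesis using toggle_toggle[OF A rows] unfolding c_def d_def by simp
qed

text \<open>
  Dually, the old solo upper elements are to the right of \<open>f 0\<close>, which has become the first solo upper
  element.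
\<close>
lemma raising_imp_lowering:
  assumes A: "A \<in> P_arrays P R" and A': "A' \<in> P_arrays P R" and up: "raising R r A = Some A'"
  shows "lowering R r A' = Some A"
proof -
  let ?U = "row_elems A r" and ?L = "row_elems A (r + 1)"
  define \<phi> where "\<phi> = alignment R A r"
  have al: "aligned ?U ?L \<phi>" unfolding \<phi>_def by (rule aligned_alignment[OF A])
  have inc: "increasing ?U \<phi>" "increasing ?L \<phi>"
    and BA: "\<And>a b. solo ?U ?L \<phi> a \<Longrightarrow> solo ?L ?U \<phi> b \<Longrightarrow> \<phi> b < \<phi> a"
    using al unfolding aligned_def arranged_def by blast+
  have "\<not> (\<forall>y\<in>?L. \<exists>x\<in>?U. \<phi> x = \<phi> y)"
    using up unfolding raising_def Let_def \<phi>_def[symmetric] by (auto split: if_splits)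
  then obtain x where x: "solo ?L ?U \<phi> x" unfolding solo_def by blast
  have fin: "finite ?L" by (rule finite_subset[OF row_elems_subset[OF A] finite_P])
  have "\<forall>y. solo ?L ?U \<phi> y \<longrightarrow> \<phi> y < Suc (Max (\<phi> ` ?L))"
    using Max_ge[OF finite_imageI[OF fin], OF imageI] unfolding solo_def less_Suc_eq_le by blast
  from ex_has_greatest_nat[of "solo ?L ?U \<phi>", OF x this]
  obtain s where s: "solo ?L ?U \<phi> s" and greatest: "\<And>x. solo ?L ?U \<phi> x \<Longrightarrow> \<phi> x \<le> \<phi> s"
    by blast
  obtain t f g where f0: "f 0 = s" and blk: "block (?U \<union> ?L) \<phi> t f g"
    using aligned_block[OF al] s by blast
  define c where "c = \<phi> (f 0)"
  define d where "d = c + t"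
  have A'_eq: "A' = toggle A r \<phi> c d"
    using raising_eq[where f = f, OF A al _ _ blk] s greatest up unfolding f0 c_def d_def by simp
  have al': "aligned (swapped ?U ?L \<phi> c d) (swapped ?L ?U \<phi> c d) \<phi>"
    using aligned_swapped[OF al blk c_def d_def] s greatest unfolding f0 c_def by blast
  note rows = row_elems_toggle[OF A al', folded A'_eq]
  have r: "row_elems A' r = swapped ?U ?L \<phi> c d" "row_elems A' (r + 1) = swapped ?L ?U \<phi> c d"
    unfolding rows by simp_all
  have "lowering R r A' = Some (toggle A' r \<phi> (\<phi> (f 0)) (\<phi> (f 0) + t))"
  proof (rule lowering_eq[OF A'])
    show "aligned (row_elems A' r) (row_elems A' (r + 1)) \<phi>" unfolding r by (rule al')
    show "block (row_elems A' r \<union> row_elems A' (r + 1)) \<phi> t f g" unfolding r swapped_Un by (rule blk)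
    show "solo (row_elems A' r) (row_elems A' (r + 1)) \<phi> (f 0)"
      unfolding r solo_swapped using s f0 c_def d_def by simp
    fix x assume "solo (row_elems A' r) (row_elems A' (r + 1)) \<phi> x"
    then have x: "if \<phi> x \<in> {c..d} then solo ?L ?U \<phi> x else solo ?U ?L \<phi> x"
      unfolding r solo_swapped .
    show "\<phi> (f 0) \<le> \<phi> x"
    proof (cases "\<phi> x \<in> {c..d}")
      case True
      then have "solo ?U ?L \<phi> x \<or> solo ?L ?U \<phi> x" using x by (simp only: if_True simp_thms)
      then have "x = f 0" by (rule solo_in_block[OF blk inc]) (use True c_def d_def in simp)
      then show ?thesis by simp
    next
      case False
      then have "solo ?U ?L \<phi> x" using x by (simp only: if_False)
      from less_imp_le[OF BA[OF this s]] show ?thesis unfolding f0 .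
    qed
  qed
  then show ?thesis using toggle_toggle[OF A rows] unfolding c_def d_def by simp
qed

end

theorem theorem5p10:
  fixes P :: "'a set" and R :: "'a rel" and r :: nat and A A' :: "'a parray"
  assumes "finite P" and "partial_order_on P R"
    and "three_plus_one_free P R"
    and "r \<ge> 1"
    and "A \<in> P_arrays P R" and "A' \<in> P_arrays P R"
  shows "lowering R r A = Some A' \<longleftrightarrow> raising R r A' = Some A"
proof -
  interpret free_poset P R
    by unfold_locales (use assms in auto)
  show ?thesis
    using lowering_imp_raising raising_imp_lowering assms(5,6) by blast
qed

end
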